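(* Let $K$ and $L$ be two Galois cubic number fields with the same discriminant $D=d^2$, where $d$ is a positive integer. Then $$\langle O_K^0,q_K\rangle\cong\langle O_L^0,q_L\rangle\cong\begin{cases}2d(x^2+xy+y^2)&\text{if }3\nmid d,\\ \frac{2d}{3}(x^2+xy+y^2)&\text{otherwise}.\end{cases}$$ Moreover, there exists such an isometry $\langle O_K^0,q_K\rangle\to\langle O_L^0,q_L\rangle$ which extends to an isometry between $\langle O_K,\tilde q_K\rangle$ and $\langle O_L,\tilde q_L\rangle$.
   Context: For a number field $M$, $\tilde q_M:O_M\to\mathbb{Z}$ is $\tilde q_M(x)=\mathrm{tr}_{M/\mathbb{Q}}(x^2)$, $O_M^0=\{x\in O_M:\mathrm{tr}_{M/\mathbb{Q}}(x)=0\}$, and $q_M=\tilde q_M|_{O_M^0}$. Isomorphism of quadratic modules means a $\mathbb{Z}$-module isomorphism carrying one quadratic form to the other. *)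

theory Defs
  imports
    "HOL-Library.Product_Plus"
    "HOL-Computational_Algebra.Polynomial"
    "Jordan_Normal_Form.Determinant"
begin

text \<open>
  Number fields are rendered as subfields \<open>M\<close>, of finite dimension over the rationals, of an
  arbitrary ambient field of characteristic \<open>0\<close>. The ambient field carries the structure of a
  vector space over the rationals and of a module over the integers.
\<close>

global_interpretation rat_vs:
  vector_space "\<lambda>(q::rat) (x::'a::field_char_0). of_rat q * x"
  by unfold_locales (simp_all add: algebra_simps of_rat_add of_rat_mult)

global_interpretation int_mod:
  Modules.module "\<lambda>(k::int) (x::'a::field_char_0). of_int k * x"
  by unfold_locales (simp_all add: algebra_simps)

definition is_subfield :: "'a::field_char_0 set \<Rightarrow> bool" where
  "is_subfield M \<longleftrightarrow> 0 \<in> M \<and> 1 \<in> M \<and>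
     (\<forall>x\<in>M. \<forall>y\<in>M. x + y \<in> M \<and> x * y \<in> M) \<and>
     (\<forall>x\<in>M. - x \<in> M \<and> inverse x \<in> M)"

definition number_field :: "'a::field_char_0 set \<Rightarrow> bool" where
  "number_field M \<longleftrightarrow> is_subfield M \<and> (\<exists>B. finite B \<and> rat_vs.span B = M)"

definition field_degree :: "'a::field_char_0 set \<Rightarrow> nat" where
  "field_degree M = rat_vs.dim M"

text \<open>
  Only the values of an automorphism on \<open>M\<close> matter. It fixes the rationals automatically.
\<close>

definition field_aut :: "'a::field_char_0 set \<Rightarrow> ('a \<Rightarrow> 'a) \<Rightarrow> bool" where
  "field_aut M \<sigma> \<longleftrightarrow> bij_betw \<sigma> M M \<and>
     (\<forall>x\<in>M. \<forall>y\<in>M. \<sigma> (x + y) = \<sigma> x + \<sigma> y \<and> \<sigma> (x * y) = \<sigma> x * \<sigma> y)"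

definition galois_over_rat :: "'a::field_char_0 set \<Rightarrow> bool" where
  "galois_over_rat M \<longleftrightarrow> {x \<in> M. \<forall>\<sigma>. field_aut M \<sigma> \<longrightarrow> \<sigma> x = x} = \<rat>"

definition galois_cubic_field :: "'a::field_char_0 set \<Rightarrow> bool" where
  "galois_cubic_field M \<longleftrightarrow> number_field M \<and> field_degree M = 3 \<and> galois_over_rat M"

text \<open>
  The trace of \<open>x\<close> is the trace of the linear map \<open>y \<mapsto> x * y\<close> on \<open>M\<close>: the sum of the
  diagonal entries of its matrix with respect to a basis (it does not depend on the basis).
\<close>

definition rat_basis :: "'a::field_char_0 set \<Rightarrow> 'a set \<Rightarrow> bool" where
  "rat_basis M B \<longleftrightarrow> finite B \<and> rat_vs.independent B \<and> rat_vs.span B = M"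

definition field_trace :: "'a::field_char_0 set \<Rightarrow> 'a \<Rightarrow> rat" where
  "field_trace M x =
     (let B = (SOME B. rat_basis M B) in \<Sum>b\<in>B. rat_vs.representation B (x * b) b)"

definition ring_of_integers :: "'a::field_char_0 set \<Rightarrow> 'a set" where
  "ring_of_integers M = {x \<in> M. algebraic_int x}"

definition trace_zero_integers :: "'a::field_char_0 set \<Rightarrow> 'a set" where
  "trace_zero_integers M = {x \<in> ring_of_integers M. field_trace M x = 0}"

definition integral_basis :: "'a::field_char_0 set \<Rightarrow> 'a list \<Rightarrow> bool" where
  "integral_basis M bs \<longleftrightarrow> distinct bs \<and> int_mod.independent (set bs) \<and>
     int_mod.span (set bs) = ring_of_integers M"

text \<open>The discriminant does not depend on the chosen integral basis.\<close>

definition field_discriminant :: "'a::field_char_0 set \<Rightarrow> rat" where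
  "field_discriminant M =
     (let bs = (SOME bs. integral_basis M bs); n = length bs
      in det (mat n n (\<lambda>(i, j). field_trace M (bs ! i * bs ! j))))"

text \<open>
  The form \<open>x \<mapsto> tr (x\<^sup>2)\<close>. It takes integer values on the ring of integers; its values are kept
  in the rationals, where the trace lives. The form on the trace-zero integers is its
  restriction.
\<close>

definition trace_form :: "'a::field_char_0 set \<Rightarrow> 'a \<Rightarrow> rat" where
  "trace_form M x = field_trace M (x ^ 2)"

text \<open>
  The binary form \<open>c (x\<^sup>2 + x y + y\<^sup>2)\<close> on the free module of pairs of integers.
\<close>

definition hex_form :: "rat \<Rightarrow> int \<times> int \<Rightarrow> rat" where
  "hex_form c = (\<lambda>(x, y). c * of_int (x ^ 2 + x * y + y ^ 2))"

text \<open>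
  Here \<open>A\<close> and \<open>B\<close> are subgroups, so additivity on \<open>A\<close> is the same as linearity over the integers.
\<close>

definition quad_isometry ::
    "'a::ab_group_add set \<Rightarrow> ('a \<Rightarrow> rat) \<Rightarrow> 'b::ab_group_add set \<Rightarrow> ('b \<Rightarrow> rat) \<Rightarrow> ('a \<Rightarrow> 'b) \<Rightarrow> bool"
  where
  "quad_isometry A q B q' f \<longleftrightarrow> bij_betw f A B \<and>
     (\<forall>x\<in>A. \<forall>y\<in>A. f (x + y) = f x + f y) \<and> (\<forall>x\<in>A. q' (f x) = q x)"

definition quad_isomorphic ::
    "'a::ab_group_add set \<Rightarrow> ('a \<Rightarrow> rat) \<Rightarrow> 'b::ab_group_add set \<Rightarrow> ('b \<Rightarrow> rat) \<Rightarrow> bool"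
  where
  "quad_isomorphic A q B q' \<longleftrightarrow> (\<exists>f. quad_isometry A q B q' f)"

end

theory Submission
  imports Defs "Jordan_Normal_Form.Char_Poly"
begin

text \<open>
  Let \<open>\<sigma>\<close> generate the Galois group of \<open>M\<close>. Since \<open>1 + \<sigma> + \<sigma>\<^sup>2\<close> vanishes on the trace-zero
  integers, they form a module over the Eisenstein integers, which is generated by a shortest
  nonzero vector \<open>a\<close>; as a lattice they have the basis \<open>a\<close>, \<open>\<sigma> a\<close>, on which the trace form is
  \<open>T (s\<^sup>2 - s t + t\<^sup>2)\<close> with \<open>T = tr (a\<^sup>2)\<close>. Either all traces of integers are divisible by \<open>3\<close>, and
  the ring of integers is spanned by \<open>1\<close>, \<open>a\<close>, \<open>\<sigma> a\<close>; or, for a suitable sign of \<open>a\<close>, it is spanned by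
  \<open>(1 + a - \<sigma> a) / 3\<close>, \<open>a\<close>, \<open>\<sigma> a\<close>. The discriminant is \<open>9 T\<^sup>2 / 4\<close> in the first case and
  \<open>T\<^sup>2 / 4\<close> in the second, and integrality of the form decides that the first case occurs if and
  only if \<open>3\<close> divides \<open>d\<close>. So everything is determined by \<open>d\<close>, and matching the bases
  of \<open>K\<close> and \<open>L\<close> yields the isometries.
\<close>

section \<open>Basis independence of traces and of ranks\<close>

text \<open>Both sums equal the double sum of the \<open>C\<close>-coordinates of \<open>b\<close>
  times the \<open>B\<close>-coordinates of \<open>f c\<close>; this is the identity tr(PQ) =
  tr(QP). Stated for modules, it serves rational vector spaces and integral lattices alike.\<close>

lemma (in Modules.module) trace_representation_unique:
  assumes B: "independent B" "finite B" and C: "independent C" "finite C"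
    and BC: "span B = span C"
    and f_span: "\<And>x. x \<in> span B \<Longrightarrow> f x \<in> span B"
    and f_add: "\<And>x y. x \<in> span B \<Longrightarrow> y \<in> span B \<Longrightarrow> f (x + y) = f x + f y"
    and f_scale: "\<And>k x. x \<in> span B \<Longrightarrow> f (k *s x) = k *s f x"
  shows "(\<Sum>b\<in>B. representation B (f b) b) = (\<Sum>c\<in>C. representation C (f c) c)"
proof -
  have f_zero: "f 0 = 0"
    using f_scale[OF span_zero, of 0] by simp
  have f_sum: "f (\<Sum>i\<in>S. k i *s g i) = (\<Sum>i\<in>S. k i *s f (g i))"
    if "finite S" "\<And>i. i \<in> S \<Longrightarrow> g i \<in> span B" for S k and g :: "'b \<Rightarrow> 'b"
    using that
  proof (induction S rule: finite_induct)
    case (insert i S)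
    then have "(\<Sum>i\<in>S. k i *s g i) \<in> span B"
      by (intro span_sum span_scale) auto
    with insert show ?case
      by (simp add: f_add f_scale span_scale)
  qed (simp add: f_zero)
  have B_in: "b \<in> span C" if "b \<in> B" for b
    using that BC span_base by blast
  have C_in: "c \<in> span B" if "c \<in> C" for c
    using that BC span_base by blast
  have "(\<Sum>b\<in>B. representation B (f b) b)
      = (\<Sum>b\<in>B. \<Sum>c\<in>C. representation C b c * representation B (f c) b)"
  proof (rule sum.cong[OF refl])
    fix b assume b: "b \<in> B"
    have "b = (\<Sum>c\<in>C. representation C b c *s c)"
      using sum_representation_eq[OF C(1) B_in[OF b] C(2) order_refl] by simp
    then have "f b = f (\<Sum>c\<in>C. representation C b c *s c)"
      by simp
    also have "\<dots> = (\<Sum>c\<in>C. representation C b c *s f c)"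
      by (rule f_sum) (use C C_in in auto)
    finally show "representation B (f b) b = (\<Sum>c\<in>C. representation C b c * representation B (f c) b)"
      using B C_in f_span by (simp add: representation_sum representation_scale span_scale)
  qed
  also have "\<dots> = (\<Sum>c\<in>C. \<Sum>b\<in>B. representation B (f c) b * representation C b c)"
    by (subst sum.swap) (simp add: mult.commute)
  also have "\<dots> = (\<Sum>c\<in>C. representation C (f c) c)"
  proof (rule sum.cong[OF refl])
    fix c assume c: "c \<in> C"
    have "f c = (\<Sum>b\<in>B. representation B (f c) b *s b)"
      using sum_representation_eq[OF B(1) f_span[OF C_in[OF c]] B(2) order_refl] by simp
    then have "representation C (f c) c = representation C (\<Sum>b\<in>B. representation B (f c) b *s b) c"
      by simp
    also have "\<dots> = (\<Sum>b\<in>B. representation B (f c) b * representation C b c)"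
      using C B_in by (simp add: representation_sum representation_scale span_scale)
    finally show "(\<Sum>b\<in>B. representation B (f c) b * representation C b c) = representation C (f c) c"
      by simp
  qed
  finally show ?thesis .
qed

text \<open>The trace of the identity map counts the elements of a basis.\<close>

lemma int_mod_card_basis_unique:
  fixes B C :: "'a::field_char_0 set"
  assumes "int_mod.independent B" "finite B" "int_mod.independent C" "finite C"
    and "int_mod.span B = int_mod.span C"
  shows "card B = card C"
proof -
  have "(\<Sum>b\<in>B. int_mod.representation B b b) = (\<Sum>c\<in>C. int_mod.representation C c c)"
    by (rule int_mod.trace_representation_unique) (use assms in auto)
  moreover have "(\<Sum>b\<in>X. int_mod.representation X b b) = int (card X)"
    if "int_mod.independent X" for X :: "'a set"
    using that by (simp add: int_mod.representation_basis)
  ultimately show ?thesis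
    using assms by simp
qed

section \<open>Algebraic integers\<close>

text \<open>The determinant trick: \<open>x\<close> acts on the generators by an integer matrix, and
  the generators themselves form an eigenvector for \<open>x\<close>, so \<open>x\<close> is a root
  of the monic integral characteristic polynomial. The nonzero \<open>v\<close> keeps that vector
  from vanishing.\<close>

lemma algebraic_int_if_stable_span:
  fixes x :: "'a::field_char_0"
  assumes "finite V" "v \<in> V" "v \<noteq> 0"
    and stable: "\<And>v. v \<in> V \<Longrightarrow> x * v \<in> int_mod.span V"
  shows "algebraic_int x"
proof -
  obtain vs where vs: "set vs = V" "distinct vs"
    using finite_distinct_list[OF \<open>finite V\<close>] by blast
  define n where "n = length vs"
  have "\<forall>v\<in>V. \<exists>u. x * v = (\<Sum>w\<in>V. of_int (u w) * w)"
    using stable unfolding int_mod.span_finite[OF \<open>finite V\<close>] by auto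
  then obtain u where u: "\<And>v. v \<in> V \<Longrightarrow> x * v = (\<Sum>w\<in>V. of_int (u v w) * w)"
    by metis
  define A where "A = mat n n (\<lambda>(i, j). u (vs ! i) (vs ! j))"
  have A: "A \<in> carrier_mat n n"
    by (simp add: A_def)
  let ?A = "map_mat of_int A :: 'a mat"
  have rows: "(\<Sum>w\<in>V. g w) = (\<Sum>j<n. g (vs ! j))" for g :: "'a \<Rightarrow> 'a"
    using vs n_def by (metis bij_betw_nth sum.reindex_bij_betw)
  have "eigenvector ?A (vec n ((!) vs)) x"
    unfolding eigenvector_def
  proof (intro conjI)
    show "vec n ((!) vs) \<in> carrier_vec (dim_row ?A)"
      using A by simp
    obtain i where "i < n" "vs ! i = v"
      using assms(2) vs n_def by (metis in_set_conv_nth)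
    then show "vec n ((!) vs) \<noteq> 0\<^sub>v (dim_row ?A)"
      using A \<open>v \<noteq> 0\<close> by (metis carrier_matD(1) index_map_mat(2) index_vec index_zero_vec(1))
    show "?A *\<^sub>v vec n ((!) vs) = x \<cdot>\<^sub>v vec n ((!) vs)"
    proof (rule eq_vecI)
      fix i assume "i < dim_vec (x \<cdot>\<^sub>v vec n ((!) vs))"
      then have i: "i < n" by simp
      then have "vs ! i \<in> V"
        using vs n_def by auto
      from u[OF this] show "(?A *\<^sub>v vec n ((!) vs)) $ i = (x \<cdot>\<^sub>v vec n ((!) vs)) $ i"
        using i by (simp add: A_def scalar_prod_def rows atLeast0LessThan)
    qed (use A in simp)
  qed
  then have "eigenvalue ?A x"
    unfolding eigenvalue_def by blast
  then have "poly (char_poly ?A) x = 0"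
    using eigenvalue_root_char_poly[of ?A n] A by simp
  moreover have "char_poly ?A = map_poly of_int (char_poly A)"
    using of_int_hom.char_poly_hom[OF A] by simp
  moreover have "lead_coeff (char_poly A) = 1"
    using degree_monic_char_poly[OF A] by simp
  ultimately show ?thesis
    unfolding algebraic_int_altdef_ipoly by auto
qed

lemma algebraic_int_power_reduce:
  fixes x :: "'a::field_char_0"
  assumes "algebraic_int x"
  obtains n c where "x ^ n = (\<Sum>i<n. of_int (c i) * x ^ i)" "n > 0"
proof -
  obtain p :: "int poly" where p: "poly (map_poly of_int p) x = 0" "lead_coeff p = 1"
    using assms unfolding algebraic_int_altdef_ipoly by auto
  define n where "n = degree p"
  have "0 = (\<Sum>i\<le>n. of_int (coeff p i) * x ^ i)"
    using p(1) unfolding poly_altdef n_def by (simp add: degree_map_poly coeff_map_poly)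
  also have "\<dots> = (\<Sum>i<n. of_int (coeff p i) * x ^ i) + x ^ n"
    using p(2) by (simp add: n_def lessThan_Suc_atMost[symmetric])
  finally have "x ^ n = (\<Sum>i<n. of_int (- coeff p i) * x ^ i)"
    by (simp add: sum_negf eq_neg_iff_add_eq_0 add.commute)
  \<comment> \<open>For \<open>n = 0\<close> the sum is empty and the relation would read
    \<open>1 = 0\<close>.\<close>
  moreover from this have "n > 0"
    by (cases n) auto
  ultimately show ?thesis
    by (rule that)
qed

text \<open>The monomials below the two reduction exponents span a module closed under
  multiplication by \<open>x\<close> and by \<open>y\<close>, hence also by \<open>x + y\<close> and
  \<open>x * y\<close>, as the determinant trick requires. The element \<open>1\<close> provides its
  nonzero vector.\<close>

lemma algebraic_int_pair_module:
  fixes x y :: "'a::field_char_0"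
  assumes "algebraic_int x" "algebraic_int y"
  obtains V where "finite V" "1 \<in> V"
    "\<And>v. v \<in> int_mod.span V \<Longrightarrow> x * v \<in> int_mod.span V"
    "\<And>v. v \<in> int_mod.span V \<Longrightarrow> y * v \<in> int_mod.span V"
proof -
  obtain m c where m: "x ^ m = (\<Sum>i<m. of_int (c i) * x ^ i)" "m > 0"
    using algebraic_int_power_reduce[OF assms(1)] .
  obtain n d where n: "y ^ n = (\<Sum>i<n. of_int (d i) * y ^ i)" "n > 0"
    using algebraic_int_power_reduce[OF assms(2)] .
  define V where "V = (\<lambda>(i, j). x ^ i * y ^ j) ` ({..<m} \<times> {..<n})"
  have V: "x ^ i * y ^ j \<in> int_mod.span V" if "i < m" "j < n" for i j
    using that by (auto simp: V_def intro!: int_mod.span_base)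
  have Vx: "x * v \<in> int_mod.span V" if "v \<in> V" for v
  proof -
    from that obtain i j where ij: "i < m" "j < n" "v = x ^ i * y ^ j"
      by (auto simp: V_def)
    show ?thesis
    proof (cases "Suc i < m")
      case True
      then show ?thesis using V[of "Suc i" j] ij by (simp add: mult.assoc)
    next
      case False
      then have "Suc i = m" using ij by simp
      \<comment> \<open>At the top exponent the monic relation for \<open>x ^ m\<close> brings the
        power back into range.\<close>
      then have "x * v = x ^ m * y ^ j" using ij by (auto simp: mult.assoc)
      also have "\<dots> = (\<Sum>i<m. of_int (c i) * (x ^ i * y ^ j))"
        by (simp add: m(1) sum_distrib_right mult.assoc)
      also have "\<dots> \<in> int_mod.span V"
        by (intro int_mod.span_sum int_mod.span_scale V) (use ij in auto)
      finally show ?thesis .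
    qed
  qed
  have Vy: "y * v \<in> int_mod.span V" if "v \<in> V" for v
  proof -
    from that obtain i j where ij: "i < m" "j < n" "v = x ^ i * y ^ j"
      by (auto simp: V_def)
    show ?thesis
    proof (cases "Suc j < n")
      case True
      then show ?thesis using V[of i "Suc j"] ij by (simp add: mult.left_commute)
    next
      case False
      then have "Suc j = n" using ij by simp
      then have "y * v = x ^ i * y ^ n" using ij by (auto simp: mult.left_commute)
      also have "\<dots> = (\<Sum>j<n. of_int (d j) * (x ^ i * y ^ j))"
        by (simp add: n(1) sum_distrib_left mult.left_commute)
      also have "\<dots> \<in> int_mod.span V"
        by (intro int_mod.span_sum int_mod.span_scale V) (use ij in auto)
      finally show ?thesis .
    qed
  qed
  have stable: "z * v \<in> int_mod.span V"
    if "\<And>v. v \<in> V \<Longrightarrow> z * v \<in> int_mod.span V" "v \<in> int_mod.span V" for z v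
    using that(2)
  proof (induction rule: int_mod.span_induct_alt)
    case base
    show ?case by (simp add: int_mod.span_zero)
  next
    case (step k w u)
    have "z * (of_int k * w + u) = of_int k * (z * w) + z * u"
      by (simp add: algebra_simps)
    then show ?case
      using step that(1) by (auto intro: int_mod.span_add int_mod.span_scale)
  qed
  show ?thesis
  proof (rule that)
    show "1 \<in> V" using m n by (force simp: V_def)
  qed (use Vx Vy stable in \<open>auto simp: V_def\<close>)
qed

lemma algebraic_int_add:
  fixes x y :: "'a::field_char_0"
  assumes "algebraic_int x" "algebraic_int y"
  shows "algebraic_int (x + y)"
proof -
  obtain V where V: "finite V" "1 \<in> V"
    "\<And>v. v \<in> int_mod.span V \<Longrightarrow> x * v \<in> int_mod.span V"
    "\<And>v. v \<in> int_mod.span V \<Longrightarrow> y * v \<in> int_mod.span V"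
    using algebraic_int_pair_module[OF assms] by blast
  show ?thesis
    by (rule algebraic_int_if_stable_span[OF V(1,2)])
      (use V in \<open>auto simp: ring_distribs intro: int_mod.span_add int_mod.span_base\<close>)
qed

lemma algebraic_int_mult:
  fixes x y :: "'a::field_char_0"
  assumes "algebraic_int x" "algebraic_int y"
  shows "algebraic_int (x * y)"
proof -
  obtain V where V: "finite V" "1 \<in> V"
    "\<And>v. v \<in> int_mod.span V \<Longrightarrow> x * v \<in> int_mod.span V"
    "\<And>v. v \<in> int_mod.span V \<Longrightarrow> y * v \<in> int_mod.span V"
    using algebraic_int_pair_module[OF assms] by blast
  show ?thesis
    by (rule algebraic_int_if_stable_span[OF V(1,2)])
      (use V in \<open>auto simp: mult.assoc intro: int_mod.span_base\<close>)
qed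

lemma algebraic_int_diff:
  fixes x y :: "'a::field_char_0"
  assumes "algebraic_int x" "algebraic_int y"
  shows "algebraic_int (x - y)"
  using algebraic_int_add[of x "- y"] assms by simp

section \<open>Cubic fields and their trace\<close>

lemma (in Modules.module) span_triple:
  "x \<in> span {a, b, c} \<longleftrightarrow> (\<exists>p q r. x = p *s a + q *s b + r *s c)"
proof
  assume "x \<in> span {a, b, c}"
  then obtain p q r where "x - p *s a - q *s b - r *s c = 0"
    by (auto simp: span_breakdown_eq)
  then show "\<exists>p q r. x = p *s a + q *s b + r *s c"
    by (intro exI[of _ p] exI[of _ q] exI[of _ r]) (simp add: algebra_simps)
qed (auto intro!: span_add span_scale intro: span_base)

lemma (in Modules.module) independent_triple:
  assumes trivial: "\<And>p q r. p *s a + q *s b + r *s c = 0 \<Longrightarrow> p = 0 \<and> q = 0 \<and> r = 0"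
  shows "distinct [a, b, c]" "independent {a, b, c}"
proof -
  \<comment> \<open>Equal entries would satisfy a relation with coefficients \<open>1\<close> and
    \<open>-1\<close>.\<close>
  have "a \<noteq> b" using trivial[of 1 "-1" 0] by auto
  moreover have "a \<noteq> c" using trivial[of 1 0 "-1"] by auto
  moreover have "b \<noteq> c" using trivial[of 0 1 "-1"] by auto
  ultimately show "distinct [a, b, c]" by simp
  with trivial show "independent {a, b, c}"
    by (force simp: dependent_finite add.assoc)
qed

lemma not_Rats_linear:
  fixes x :: "'a::field_char_0"
  assumes "x \<notin> \<rat>" "of_rat p + of_rat q * x = 0"
  shows "p = 0" "q = 0"
proof -
  show "q = 0"
  proof (rule ccontr)
    assume "q \<noteq> 0"
    then have "x = of_rat (- p / q)"
      using assms(2) by (simp add: of_rat_divide of_rat_minus field_simps eq_neg_iff_add_eq_0)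
    then show False using assms(1) by simp
  qed
  with assms(2) show "p = 0" by simp
qed

locale cubic_subfield =
  fixes M :: "'a::field_char_0 set"
  assumes subfield: "is_subfield M" and dim_M: "rat_vs.dim M = 3"
begin

lemma M_0 [simp]: "0 \<in> M" and M_1 [simp]: "1 \<in> M"
  and M_add [intro]: "x \<in> M \<Longrightarrow> y \<in> M \<Longrightarrow> x + y \<in> M"
  and M_mult [intro]: "x \<in> M \<Longrightarrow> y \<in> M \<Longrightarrow> x * y \<in> M"
  and M_minus [intro]: "x \<in> M \<Longrightarrow> - x \<in> M"
  and M_inverse: "x \<in> M \<Longrightarrow> inverse x \<in> M"
  using subfield by (auto simp: is_subfield_def)

lemma M_diff [intro]: "x \<in> M \<Longrightarrow> y \<in> M \<Longrightarrow> x - y \<in> M"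
  using M_add[of x "- y"] by auto

lemma M_power [intro]: "x \<in> M \<Longrightarrow> x ^ n \<in> M"
  by (induction n) auto

lemma M_of_int [simp]: "of_int k \<in> M"
proof (induction k rule: int_induct[of _ 0])
  case (step1 i)
  then show ?case using M_add[of "of_int i" 1] by simp
next
  case (step2 i)
  then show ?case using M_diff[of "of_int i" 1] by simp
qed simp

lemma M_of_rat [simp]: "of_rat q \<in> M"
proof -
  obtain a b where "q = of_int a / of_int b"
    by (metis quotient_of_div surj_pair)
  then have "of_rat q = of_int a * inverse (of_int b :: 'a)"
    by (simp add: of_rat_divide flip: divide_inverse)
  then show ?thesis
    using M_inverse[OF M_of_int] by (auto intro: M_mult)
qed

lemma rat_basis_exists:
  obtains B where "rat_basis M B" "card B = 3"
proof -
  obtain B where B: "B \<subseteq> M" "rat_vs.independent B" "M \<subseteq> rat_vs.span B" "card B = 3"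
    using rat_vs.basis_exists[of M] dim_M by metis
  have "rat_vs.subspace M"
    by (auto simp: rat_vs.subspace_def)
  then have "rat_vs.span B = M"
    using B rat_vs.span_minimal by blast
  moreover have "finite B"
    using B(4) card.infinite by fastforce
  ultimately show ?thesis
    using that B by (simp add: rat_basis_def)
qed

lemma card_independent_le:
  assumes "rat_vs.independent S" "S \<subseteq> M"
  shows "finite S" "card S \<le> 3"
proof -
  obtain B where "rat_basis M B" "card B = 3"
    using rat_basis_exists .
  then show "finite S" "card S \<le> 3"
    using rat_vs.independent_span_bound[of B S] assms by (auto simp: rat_basis_def)
qed

lemma not_subset_span_if_card_less:
  assumes "finite S" "card S < 3"
  shows "\<not> M \<subseteq> rat_vs.span S"
proof
  assume M: "M \<subseteq> rat_vs.span S"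
  obtain B where B: "rat_basis M B" "card B = 3"
    using rat_basis_exists .
  then have "B \<subseteq> rat_vs.span S"
    using M rat_vs.span_superset by (auto simp: rat_basis_def)
  then show False
    using rat_vs.independent_span_bound[of S B] B assms by (auto simp: rat_basis_def)
qed

lemma irrational_exists: "\<exists>x\<in>M. x \<notin> \<rat>"
proof -
  obtain x where x: "x \<in> M" "x \<notin> rat_vs.span {1}"
    using not_subset_span_if_card_less[of "{1}"] by auto
  have "x \<notin> \<rat>"
    using x(2) rat_vs.span_scale[OF rat_vs.span_base, of 1 "{1}"] by (auto elim!: Rats_cases)
  with x show ?thesis by blast
qed

text \<open>An element outside the span would give four independent elements in dimension
  three.\<close>

lemma rat_basis_triple:
  assumes "a \<in> M" "b \<in> M" "c \<in> M"
    and trivial: "\<And>p q r. of_rat p * a + of_rat q * b + of_rat r * c = 0 \<Longrightarrow> p = 0 \<and> q = 0 \<and> r = 0"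
  shows "rat_basis M {a, b, c}"
proof -
  note ind = rat_vs.independent_triple[of a b c, OF trivial]
  have "x \<in> rat_vs.span {a, b, c}" if "x \<in> M" for x
  proof (rule ccontr)
    assume x: "x \<notin> rat_vs.span {a, b, c}"
    then have "x \<notin> {a, b, c}"
      using rat_vs.span_base[of x "{a, b, c}"] by blast
    moreover have "rat_vs.independent (insert x {a, b, c})"
      using ind(2) x by (rule rat_vs.independent_insertI[rotated])
    ultimately show False
      using card_independent_le(2)[of "insert x {a, b, c}"] ind(1) assms(1-3) that
      by (simp add: card_insert_if)
  qed
  moreover have "x \<in> M" if "x \<in> rat_vs.span {a, b, c}" for x
    using that assms(1-3) by (auto simp: rat_vs.span_triple intro!: M_add M_mult)
  ultimately show ?thesis
    using ind by (auto simp: rat_basis_def)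
qed

lemma triple_coordinates:
  assumes "a \<in> M" "b \<in> M" "c \<in> M"
    and "\<And>p q r. of_rat p * a + of_rat q * b + of_rat r * c = 0 \<Longrightarrow> p = 0 \<and> q = 0 \<and> r = 0"
    and "x \<in> M"
  obtains p q r where "x = of_rat p * a + of_rat q * b + of_rat r * c"
proof -
  have "x \<in> rat_vs.span {a, b, c}"
    using rat_basis_triple[OF assms(1-4)] assms(5) by (simp add: rat_basis_def)
  then show ?thesis
    using that by (auto simp: rat_vs.span_triple)
qed

text \<open>
  An element of degree \<open>2\<close> would make the dimension of \<open>M\<close> even: for \<open>y\<close> outside the span of
  \<open>1\<close> and \<open>x\<close>, the product \<open>x * y\<close> would be independent of \<open>1\<close>, \<open>x\<close> and \<open>y\<close>.
\<close>

lemma irrational_powers_independent: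
  assumes x: "x \<in> M" "x \<notin> \<rat>"
    and rel: "of_rat p * 1 + of_rat q * x + of_rat r * x ^ 2 = 0"
  shows "p = 0 \<and> q = 0 \<and> r = 0"
proof (cases "r = 0")
  case True
  then show ?thesis using not_Rats_linear[OF x(2), of p q] rel by simp
next
  case False
  define P Q where "P = - p / r" and "Q = - q / r"
  have x2: "x * x = of_rat P + of_rat Q * x"
  proof -
    have "of_rat r * (x * x - of_rat P - of_rat Q * x) = 0"
      using rel False by (simp add: P_def Q_def of_rat_divide of_rat_minus algebra_simps power2_eq_square)
    then have "x * x - of_rat P - of_rat Q * x = 0"
      using False by simp
    then show ?thesis by (simp add: algebra_simps)
  qed
  have "card {1, x} < 3"
    by (simp add: card_insert_if)
  then obtain y where y: "y \<in> M" "y \<notin> rat_vs.span {1, x}"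
    using not_subset_span_if_card_less[of "{1, x}"] by auto
  have y': "y \<noteq> of_rat u + of_rat v * x" for u v
  proof
    assume "y = of_rat u + of_rat v * x"
    then have "y = of_rat u * 1 + of_rat v * x" by simp
    moreover have "of_rat u * 1 + of_rat v * x \<in> rat_vs.span {1, x}"
      by (intro rat_vs.span_add rat_vs.span_scale rat_vs.span_base) auto
    ultimately show False using y(2) by simp
  qed
  have trivial: "u = 0 \<and> v = 0 \<and> w = 0"
    if "of_rat u * 1 + of_rat v * x + of_rat w * y = 0" for u v w
  proof -
    have "w = 0"
    proof (rule ccontr)
      assume w: "w \<noteq> 0"
      have "of_rat w * y = - of_rat u - of_rat v * x"
        using that by (simp add: algebra_simps eq_neg_iff_add_eq_0)
      then have "y = of_rat (- u / w) + of_rat (- v / w) * x"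
        using w by (simp add: of_rat_divide of_rat_minus field_simps)
      with y' show False by blast
    qed
    with that not_Rats_linear[OF x(2), of u v] show ?thesis by simp
  qed
  obtain u v w where "x * y = of_rat u * 1 + of_rat v * x + of_rat w * y"
    by (rule triple_coordinates[OF M_1 x(1) y(1) trivial M_mult[OF x(1) y(1)]])
  then have xy: "(x - of_rat w) * y = of_rat u + of_rat v * x"
    by (simp add: algebra_simps)
  \<comment> \<open>The factor \<open>x + of_rat (w - Q)\<close> is conjugate to
    \<open>x - of_rat w\<close>: by \<open>x2\<close> the terms in \<open>x\<close> cancel from
    their product, leaving the rational \<open>c\<close>.\<close>
  define c where "c = P - w * w + w * Q"
  have c: "(x + of_rat (w - Q)) * (x - of_rat w) = of_rat c"
    using x2 by (simp add: c_def of_rat_add of_rat_diff of_rat_mult algebra_simps)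
  have "c \<noteq> 0"
  proof
    assume "c = 0"
    then have "x = - of_rat (w - Q) \<or> x = of_rat w"
      using c by (simp add: eq_neg_iff_add_eq_0)
    then show False using x(2) by (metis Rats_minus_iff Rats_of_rat)
  qed
  \<comment> \<open>Multiplying \<open>xy\<close> by the conjugate factor expresses \<open>y\<close>
    through \<open>1\<close> and \<open>x\<close>, against the choice of \<open>y\<close>.\<close>
  have "of_rat c * y = (x + of_rat (w - Q)) * (of_rat u + of_rat v * x)"
    using xy c by (metis mult.assoc)
  also have "\<dots> = of_rat (u * (w - Q)) + of_rat (u + v * (w - Q)) * x + of_rat v * (x * x)"
    by (simp add: of_rat_add of_rat_diff of_rat_mult algebra_simps)
  also have "\<dots> = of_rat (u * (w - Q) + v * P) + of_rat (u + v * (w - Q) + v * Q) * x"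
    unfolding x2 by (simp add: of_rat_add of_rat_diff of_rat_mult algebra_simps)
  finally have "y = of_rat ((u * (w - Q) + v * P) / c) + of_rat ((u + v * (w - Q) + v * Q) / c) * x"
    using \<open>c \<noteq> 0\<close> by (simp add: of_rat_divide field_simps)
  with y' show ?thesis by blast
qed

lemma irrational_coordinates:
  assumes x: "x \<in> M" "x \<notin> \<rat>" and "y \<in> M"
  obtains p q r where "y = of_rat p + of_rat q * x + of_rat r * x ^ 2"
proof -
  obtain p q r where "y = of_rat p * 1 + of_rat q * x + of_rat r * x ^ 2"
    by (rule triple_coordinates[OF M_1 x(1) M_power[OF x(1)] _ assms(3)])
      (use irrational_powers_independent[OF x] in blast)
  then show ?thesis using that by simp
qed

lemma rat_basis_powers:
  assumes x: "x \<in> M" "x \<notin> \<rat>"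
  shows "rat_basis M {1, x, x ^ 2}" "distinct [1, x, x ^ 2]"
proof -
  show "rat_basis M {1, x, x ^ 2}"
    by (rule rat_basis_triple[OF M_1 x(1) M_power[OF x(1)]])
      (use irrational_powers_independent[OF x] in blast)
  show "distinct [1, x, x ^ 2]"
    by (rule rat_vs.independent_triple)
      (use irrational_powers_independent[OF x] in blast)
qed

text \<open>The definition picks a basis by \<open>SOME\<close>; basis independence allows any
  convenient one.\<close>

lemma field_trace_eq:
  assumes B: "rat_basis M B" and x: "x \<in> M"
  shows "field_trace M x = (\<Sum>b\<in>B. rat_vs.representation B (x * b) b)"
proof -
  define C where "C = (SOME B. rat_basis M B)"
  have C: "rat_basis M C"
    unfolding C_def using B by (rule someI)
  have "(\<Sum>b\<in>C. rat_vs.representation C (x * b) b) = (\<Sum>b\<in>B. rat_vs.representation B (x * b) b)"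
    by (rule rat_vs.trace_representation_unique[where f = "\<lambda>b. x * b"])
      (simp_all add: B[unfolded rat_basis_def] C[unfolded rat_basis_def] x M_mult
        distrib_left mult.left_commute)
  then show ?thesis
    by (simp add: field_trace_def Let_def C_def)
qed

lemma field_trace_of_rat: "field_trace M (of_rat q) = 3 * q"
proof -
  obtain B where B: "rat_basis M B" "card B = 3"
    using rat_basis_exists .
  then have "rat_vs.representation B (of_rat q * b) b = q" if "b \<in> B" for b
    using that rat_vs.representation_scale[of B b q] rat_vs.representation_basis[of B b]
      rat_vs.span_base[OF that]
    by (simp add: rat_basis_def)
  then show ?thesis
    using B by (simp add: field_trace_eq)
qed

text \<open>In the basis \<open>1\<close>, \<open>x\<close>, \<open>x ^ 2\<close> multiplication by
  \<open>x\<close> is a companion matrix, whose diagonal is zero except for the entry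
  \<open>r\<close>.\<close>

lemma field_trace_cubic:
  assumes x: "x \<in> M" "x \<notin> \<rat>" and cubic: "x ^ 3 = of_rat p + of_rat q * x + of_rat r * x ^ 2"
  shows "field_trace M x = r"
proof -
  let ?B = "{1, x, x ^ 2}"
  note B = rat_basis_powers[OF x]
  have ind: "rat_vs.independent ?B"
    using B by (simp add: rat_basis_def)
  have "x ^ 2 \<noteq> x"
    using B(2) by auto
  note basis = rat_vs.representation_basis[OF ind]
  have "rat_vs.representation ?B (x ^ 3) (x ^ 2) = r"
  proof -
    have "x ^ 3 = of_rat p * 1 + of_rat q * x + of_rat r * x ^ 2"
      using cubic by simp
    moreover have "1 \<in> rat_vs.span ?B" "x \<in> rat_vs.span ?B" "x ^ 2 \<in> rat_vs.span ?B"
      by (simp_all add: rat_vs.span_base)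
    ultimately show ?thesis
      using B(2) \<open>x ^ 2 \<noteq> x\<close> ind basis by (simp add: rat_vs.representation_add rat_vs.representation_scale
          rat_vs.span_add rat_vs.span_scale del: mult_1_right)
  qed
  moreover have "x * x = x ^ 2" "x * x ^ 2 = x ^ 3"
    by (simp_all add: power2_eq_square power3_eq_cube)
  ultimately show ?thesis
    using B(2) by (simp add: field_trace_eq[OF B(1) x(1)] basis)
qed

end

section \<open>Cyclic cubic fields\<close>

text \<open>Divided differences: subtracting two equations and dividing by the difference of the
  roots, twice, leaves \<open>u + v + w - r\<close>.\<close>

lemma cubic_roots_sum:
  fixes u v w p q r :: "'a::field"
  assumes root: "u ^ 3 = p + q * u + r * u ^ 2" "v ^ 3 = p + q * v + r * v ^ 2"
      "w ^ 3 = p + q * w + r * w ^ 2"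
    and neq: "u \<noteq> v" "u \<noteq> w" "v \<noteq> w"
  shows "u + v + w = r"
proof -
  have divided: "u ^ 2 + u * z + z ^ 2 = q + r * (u + z)"
    if "z ^ 3 = p + q * z + r * z ^ 2" "u \<noteq> z" for z
  proof -
    have "(u - z) * (u ^ 2 + u * z + z ^ 2 - (q + r * (u + z)))
        = (u ^ 3 - (p + q * u + r * u ^ 2)) - (z ^ 3 - (p + q * z + r * z ^ 2))"
      by (simp add: algebra_simps power2_eq_square power3_eq_cube)
    also have "\<dots> = 0"
      using that root(1) by simp
    finally show ?thesis using that(2) by simp
  qed
  have "(v - w) * (u + v + w - r)
      = (u ^ 2 + u * v + v ^ 2 - (q + r * (u + v))) - (u ^ 2 + u * w + w ^ 2 - (q + r * (u + w)))"
    by (simp add: algebra_simps power2_eq_square)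
  also have "\<dots> = 0"
    using divided root neq by simp
  finally show ?thesis using neq(3) by simp
qed

lemma algebraic_int_cubic:
  fixes x :: "'a::field_char_0"
  assumes "x ^ 3 = of_int a + of_int b * x + of_int c * x ^ 2"
  shows "algebraic_int x"
  unfolding algebraic_int_altdef_ipoly
proof (intro exI conjI)
  show "poly (map_poly of_int [:- a, - b, - c, 1:]) x = 0"
    using assms by (simp add: map_poly_pCons algebra_simps power2_eq_square power3_eq_cube)
  show "lead_coeff [:- a, - b, - c, 1:] = 1"
    by simp
qed

lemma rat_common_denominator:
  fixes p q r :: rat
  obtains n a b c :: int
    where "n > 0" "of_int n * p = of_int a" "of_int n * q = of_int b" "of_int n * r = of_int c"
proof -
  obtain a1 n1 where 1: "p = of_int a1 / of_int n1" "n1 > 0"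
    by (metis quotient_of_div quotient_of_denom_pos surj_pair)
  obtain a2 n2 where 2: "q = of_int a2 / of_int n2" "n2 > 0"
    by (metis quotient_of_div quotient_of_denom_pos surj_pair)
  obtain a3 n3 where 3: "r = of_int a3 / of_int n3" "n3 > 0"
    by (metis quotient_of_div quotient_of_denom_pos surj_pair)
  show ?thesis
    by (rule that[of "n1 * n2 * n3" "a1 * n2 * n3" "a2 * n1 * n3" "a3 * n1 * n2"])
      (use 1 2 3 in auto)
qed

text \<open>Because \<open>u + v + w = 0\<close>, the terms linear in \<open>r\<close> cancel, and
  \<open>2 * (u * v + v * w + w * u)\<close> is minus the sum of the squares. It is applied to the
  conjugates of a trace-zero element.\<close>

lemma hex_form_cyclic_sum:
  fixes r s t u v w :: "'a::comm_ring_1"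
  assumes "w = - u - v"
  shows "(r + s * u + t * v) ^ 2 + (r + s * v + t * w) ^ 2 + (r + s * w + t * u) ^ 2
    = 3 * r ^ 2 + (u ^ 2 + v ^ 2 + w ^ 2) * (s ^ 2 - s * t + t ^ 2)"
  unfolding assms by (simp add: power2_eq_square algebra_simps)

text \<open>A single nontrivial automorphism is the datum; that its cube is the identity and that it
  fixes just the rationals is derived below from the dimension.\<close>

locale cyclic_cubic = cubic_subfield M for M :: "'a::field_char_0 set" +
  fixes \<sigma> :: "'a \<Rightarrow> 'a"
  assumes aut: "field_aut M \<sigma>" and nontrivial: "\<exists>x\<in>M. \<sigma> x \<noteq> x"
begin

lemma sigma_M [simp, intro]: "x \<in> M \<Longrightarrow> \<sigma> x \<in> M"
  using aut by (auto simp: field_aut_def bij_betw_def)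

lemma sigma_add: "x \<in> M \<Longrightarrow> y \<in> M \<Longrightarrow> \<sigma> (x + y) = \<sigma> x + \<sigma> y"
  and sigma_mult: "x \<in> M \<Longrightarrow> y \<in> M \<Longrightarrow> \<sigma> (x * y) = \<sigma> x * \<sigma> y"
  using aut by (auto simp: field_aut_def)

lemma sigma_inj: "x \<in> M \<Longrightarrow> y \<in> M \<Longrightarrow> \<sigma> x = \<sigma> y \<Longrightarrow> x = y"
  using aut by (auto simp: field_aut_def bij_betw_def dest: inj_onD)

lemma sigma_0 [simp]: "\<sigma> 0 = 0"
  using sigma_add[of 0 0] by simp

lemma sigma_1 [simp]: "\<sigma> 1 = 1"
  using sigma_mult[of 1 1] sigma_inj[of 1 0] by auto

lemma sigma_minus: "x \<in> M \<Longrightarrow> \<sigma> (- x) = - \<sigma> x"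
  using sigma_add[of x "- x"] by (simp add: M_minus eq_neg_iff_add_eq_0 add.commute)

lemma sigma_diff: "x \<in> M \<Longrightarrow> y \<in> M \<Longrightarrow> \<sigma> (x - y) = \<sigma> x - \<sigma> y"
  using sigma_add[of x "- y"] by (simp add: M_minus sigma_minus)

lemma sigma_power: "x \<in> M \<Longrightarrow> \<sigma> (x ^ n) = \<sigma> x ^ n"
  by (induction n) (simp_all add: sigma_mult M_power)

lemma sigma_of_int [simp]: "\<sigma> (of_int k) = of_int k"
proof (induction k rule: int_induct[of _ 0])
  case (step1 i)
  then show ?case by (simp add: sigma_add)
next
  case (step2 i)
  then show ?case by (simp add: sigma_diff)
qed simp

lemma sigma_of_rat [simp]: "\<sigma> (of_rat q) = of_rat q"
proof -
  obtain a b where q: "q = of_int a / of_int b" "b > 0"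
    by (metis quotient_of_div quotient_of_denom_pos surj_pair)
  have "of_int b * \<sigma> (of_rat q) = \<sigma> (of_int b * of_rat q)"
    by (simp add: sigma_mult)
  also have "of_int b * of_rat q = (of_int a :: 'a)"
    using q by (simp add: of_rat_divide)
  also have "\<sigma> (of_int a) = of_int b * of_rat q"
    using q by (simp add: of_rat_divide)
  finally show ?thesis using q(2) by simp
qed

lemmas sigma_simps = sigma_add sigma_mult sigma_minus sigma_diff sigma_power
  M_add M_mult M_minus M_diff M_power

text \<open>With an irrational fixed \<open>x\<close>, the basis \<open>1\<close>, \<open>x\<close>,
  \<open>x ^ 2\<close> would consist of fixed elements, making \<open>\<sigma>\<close> trivial on
  \<open>M\<close>.\<close>

lemma fixed_imp_Rats:
  assumes x: "x \<in> M" "\<sigma> x = x"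
  shows "x \<in> \<rat>"
proof (rule ccontr)
  assume irr: "x \<notin> \<rat>"
  obtain y where y: "y \<in> M" "\<sigma> y \<noteq> y"
    using nontrivial by blast
  obtain p q r where "y = of_rat p + of_rat q * x + of_rat r * x ^ 2"
    using irrational_coordinates[OF x(1) irr y(1)] .
  then have "\<sigma> y = y"
    using x by (simp add: sigma_simps)
  with y show False by simp
qed

text \<open>If \<open>\<sigma>\<close> swapped \<open>x\<close> and \<open>\<sigma> x\<close>, their
  sum and product would be fixed, hence rational, and \<open>x\<close> would be a root of a rational
  quadratic.\<close>

lemma irrational_orbit:
  assumes x: "x \<in> M" "x \<notin> \<rat>"
  shows "x \<noteq> \<sigma> x" "x \<noteq> \<sigma> (\<sigma> x)" "\<sigma> x \<noteq> \<sigma> (\<sigma> x)"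
proof -
  show neq: "x \<noteq> \<sigma> x"
    using fixed_imp_Rats[of x] x by auto
  then show "\<sigma> x \<noteq> \<sigma> (\<sigma> x)"
    using sigma_inj x by blast
  show "x \<noteq> \<sigma> (\<sigma> x)"
  proof
    assume inv: "x = \<sigma> (\<sigma> x)"
    have "x + \<sigma> x \<in> \<rat>" "x * \<sigma> x \<in> \<rat>"
      by (rule fixed_imp_Rats; use x inv in \<open>simp add: sigma_simps add.commute mult.commute\<close>)+
    then obtain p q where p: "x + \<sigma> x = of_rat p" and q: "x * \<sigma> x = of_rat q"
      by (auto elim!: Rats_cases)
    have "\<sigma> x = of_rat p - x"
      using p by (simp add: algebra_simps)
    with q have pq: "x * (of_rat p - x) = of_rat q"
      by simp
    have "of_rat q * 1 + of_rat (- p) * x + of_rat 1 * x ^ 2 = 0"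
      using pq[symmetric] by (simp add: of_rat_minus algebra_simps power2_eq_square)
    then show False
      using irrational_powers_independent[OF x] by fastforce
  qed
qed

text \<open>Applying \<open>\<sigma>\<close> to the equation of \<open>x\<close> preserves its
  rational coefficients. The third iterate is listed because it is not yet known to be
  \<open>x\<close>.\<close>

lemma irrational_cubic:
  assumes x: "x \<in> M" "x \<notin> \<rat>"
  obtains p q r where "\<And>y. y \<in> {x, \<sigma> x, \<sigma> (\<sigma> x), \<sigma> (\<sigma> (\<sigma> x))} \<Longrightarrow>
      y ^ 3 = of_rat p + of_rat q * y + of_rat r * y ^ 2"
proof -
  obtain p q r where eq: "x ^ 3 = of_rat p + of_rat q * x + of_rat r * x ^ 2"
    using irrational_coordinates[OF x M_power[OF x(1)]] .
  have step: "\<sigma> y ^ 3 = of_rat p + of_rat q * \<sigma> y + of_rat r * \<sigma> y ^ 2"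
    if "y \<in> M" "y ^ 3 = of_rat p + of_rat q * y + of_rat r * y ^ 2" for y
  proof -
    have "\<sigma> y ^ 3 = \<sigma> (y ^ 3)"
      using that(1) by (simp add: sigma_power)
    also have "\<dots> = of_rat p + of_rat q * \<sigma> y + of_rat r * \<sigma> y ^ 2"
      unfolding that(2) using that(1) by (simp add: sigma_simps)
    finally show ?thesis .
  qed
  show ?thesis
    by (rule that[of p q r]) (use eq step x in auto)
qed

text \<open>For irrational \<open>x\<close>, both \<open>x\<close> and its third iterate complete
  \<open>\<sigma> x\<close>, \<open>\<sigma> (\<sigma> x)\<close> to three distinct roots of one
  cubic. The two triples have the same sum, so the third members agree.\<close>

lemma sigma_cube:
  assumes "x \<in> M"
  shows "\<sigma> (\<sigma> (\<sigma> x)) = x"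
proof (cases "x \<in> \<rat>")
  case True
  then show ?thesis by (auto elim!: Rats_cases)
next
  case False
  note x = assms False
  obtain p q r where root: "\<And>y. y \<in> {x, \<sigma> x, \<sigma> (\<sigma> x), \<sigma> (\<sigma> (\<sigma> x))} \<Longrightarrow>
      y ^ 3 = of_rat p + of_rat q * y + of_rat r * y ^ 2"
    using irrational_cubic[OF x] by blast
  have "\<sigma> x \<noteq> \<sigma> (\<sigma> (\<sigma> x))" "\<sigma> (\<sigma> x) \<noteq> \<sigma> (\<sigma> (\<sigma> x))"
    using irrational_orbit[OF x] sigma_inj x by blast+
  then have "\<sigma> x + \<sigma> (\<sigma> x) + \<sigma> (\<sigma> (\<sigma> x)) = of_rat r"
    using irrational_orbit[OF x] by (intro cubic_roots_sum[OF root root root]) auto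
  moreover have "\<sigma> x + \<sigma> (\<sigma> x) + x = of_rat r"
    using irrational_orbit[OF x] by (intro cubic_roots_sum[OF root root root]) auto
  ultimately show ?thesis by (metis add_left_cancel)
qed

text \<open>For irrational \<open>x\<close> both sides are the quadratic coefficient of its cubic:
  one as an entry of the companion matrix, the other as the sum of the roots. From here on traces
  are computed from conjugates.\<close>

lemma of_rat_field_trace:
  assumes "x \<in> M"
  shows "of_rat (field_trace M x) = x + \<sigma> x + \<sigma> (\<sigma> x)"
proof (cases "x \<in> \<rat>")
  case True
  then show ?thesis by (auto elim!: Rats_cases simp: field_trace_of_rat of_rat_mult)
next
  case False
  note x = assms False
  obtain p q r where root: "\<And>y. y \<in> {x, \<sigma> x, \<sigma> (\<sigma> x), \<sigma> (\<sigma> (\<sigma> x))} \<Longrightarrow>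
      y ^ 3 = of_rat p + of_rat q * y + of_rat r * y ^ 2"
    using irrational_cubic[OF x] by blast
  then have "field_trace M x = r"
    by (intro field_trace_cubic[OF x]) blast
  moreover have "x + \<sigma> x + \<sigma> (\<sigma> x) = of_rat r"
    using irrational_orbit[OF x] by (intro cubic_roots_sum[OF root root root]) auto
  ultimately show ?thesis by simp
qed

lemma field_trace_eqI:
  assumes "x \<in> M" "x + \<sigma> x + \<sigma> (\<sigma> x) = of_rat q"
  shows "field_trace M x = q"
  using of_rat_field_trace[OF assms(1)] assms(2) by (simp add: of_rat_eq_iff)

lemma trace_add: "x \<in> M \<Longrightarrow> y \<in> M \<Longrightarrow> field_trace M (x + y) = field_trace M x + field_trace M y"
  by (rule field_trace_eqI) (simp_all add: sigma_simps of_rat_add of_rat_field_trace algebra_simps)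

lemma trace_scale: "x \<in> M \<Longrightarrow> field_trace M (of_rat q * x) = q * field_trace M x"
  by (rule field_trace_eqI) (simp_all add: sigma_simps of_rat_mult of_rat_field_trace algebra_simps)

lemma trace_of_int_scale: "x \<in> M \<Longrightarrow> field_trace M (of_int k * x) = of_int k * field_trace M x"
  using trace_scale[of x "of_int k"] by simp

lemma trace_diff: "x \<in> M \<Longrightarrow> y \<in> M \<Longrightarrow> field_trace M (x - y) = field_trace M x - field_trace M y"
  by (rule field_trace_eqI) (simp_all add: sigma_simps of_rat_diff of_rat_field_trace algebra_simps)

lemma trace_sigma: "x \<in> M \<Longrightarrow> field_trace M (\<sigma> x) = field_trace M x"
  by (rule field_trace_eqI) (simp_all add: of_rat_field_trace sigma_cube algebra_simps)

lemma trace_0: "field_trace M 0 = 0"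
  using field_trace_of_rat[of 0] by simp

lemma trace_of_int: "field_trace M (of_int k) = 3 * of_int k"
  using field_trace_of_rat[of "of_int k"] by simp

section \<open>Integers of a cyclic cubic field and the trace form\<close>

abbreviation "OM \<equiv> ring_of_integers M"

lemma OM_M: "x \<in> OM \<Longrightarrow> x \<in> M"
  by (simp add: ring_of_integers_def)

lemma OM_add: "x \<in> OM \<Longrightarrow> y \<in> OM \<Longrightarrow> x + y \<in> OM"
  and OM_diff: "x \<in> OM \<Longrightarrow> y \<in> OM \<Longrightarrow> x - y \<in> OM"
  and OM_mult: "x \<in> OM \<Longrightarrow> y \<in> OM \<Longrightarrow> x * y \<in> OM"
  and OM_of_int: "of_int k \<in> OM"
  by (auto simp: ring_of_integers_def algebraic_int_add algebraic_int_diff algebraic_int_mult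
      int_imp_algebraic_int)

lemma poly_sigma:
  assumes "x \<in> M"
  shows "poly (map_poly of_int p) (\<sigma> x) = \<sigma> (poly (map_poly of_int p) x)"
    and "poly (map_poly of_int p) x \<in> M"
  by (induction p) (simp_all add: map_poly_pCons sigma_simps assms)

lemma OM_sigma:
  assumes "x \<in> OM"
  shows "\<sigma> x \<in> OM"
proof -
  obtain p where "poly (map_poly of_int p) x = 0" "lead_coeff p = (1 :: int)"
    using assms by (auto simp: ring_of_integers_def algebraic_int_altdef_ipoly)
  then have "algebraic_int (\<sigma> x)"
    using poly_sigma(1)[OF OM_M[OF assms], of p] by (auto simp: algebraic_int_altdef_ipoly)
  then show ?thesis
    using assms by (simp add: ring_of_integers_def)
qed

text \<open>The sum of the conjugates is an algebraic integer and also rational.\<close>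

lemma OM_trace_Ints:
  assumes "x \<in> OM"
  obtains k where "field_trace M x = of_int k"
proof -
  have "x + \<sigma> x + \<sigma> (\<sigma> x) \<in> OM"
    using assms by (intro OM_add OM_sigma)
  then have "algebraic_int (of_rat (field_trace M x) :: 'a)"
    using assms by (simp add: ring_of_integers_def of_rat_field_trace)
  then have "(of_rat (field_trace M x) :: 'a) \<in> \<int>"
    by (rule rational_algebraic_int_is_int) simp
  then obtain k where "(of_rat (field_trace M x) :: 'a) = of_int k"
    by (rule Ints_cases)
  then have "(of_rat (field_trace M x) :: 'a) = of_rat (of_int k)"
    by simp
  then show ?thesis
    using that by (simp only: of_rat_eq_iff)
qed

lemma trace_square_expand:
  assumes a: "a \<in> M" "field_trace M a = 0"
  shows "of_rat r + of_rat s * a + of_rat t * \<sigma> a \<in> M"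
    and "field_trace M (of_rat r + of_rat s * a + of_rat t * \<sigma> a) = 3 * r"
    and "trace_form M (of_rat r + of_rat s * a + of_rat t * \<sigma> a)
      = 3 * r ^ 2 + trace_form M a * (s ^ 2 - s * t + t ^ 2)"
proof -
  let ?x = "of_rat r + of_rat s * a + of_rat t * \<sigma> a"
  define w where "w = \<sigma> (\<sigma> a)"
  have w: "w = - a - \<sigma> a"
    using of_rat_field_trace[OF a(1)] a(2) by (simp add: w_def algebra_simps eq_neg_iff_add_eq_0)
  show x: "?x \<in> M"
    using a by (simp add: sigma_simps)
  \<comment> \<open>\<open>\<sigma>\<close> rotates \<open>a\<close>, \<open>\<sigma> a\<close>,
    \<open>w\<close>, so the conjugates of \<open>?x\<close> are the three terms in
    \<open>hex_form_cyclic_sum\<close>.\<close>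
  have orbit: "\<sigma> ?x = of_rat r + of_rat s * \<sigma> a + of_rat t * w"
      "\<sigma> (of_rat r + of_rat s * \<sigma> a + of_rat t * w) = of_rat r + of_rat s * w + of_rat t * a"
    using a by (simp_all add: sigma_simps sigma_cube w_def)
  have orbit_squares:
      "\<sigma> (?x ^ 2) = (of_rat r + of_rat s * \<sigma> a + of_rat t * w) ^ 2"
      "\<sigma> ((of_rat r + of_rat s * \<sigma> a + of_rat t * w) ^ 2)
        = (of_rat r + of_rat s * w + of_rat t * a) ^ 2"
    using orbit x sigma_M[OF x] by (simp_all only: sigma_power)
  show "field_trace M ?x = 3 * r"
    by (rule field_trace_eqI[OF x], unfold orbit) (simp add: w of_rat_mult algebra_simps)
  have T: "of_rat (trace_form M a) = a ^ 2 + \<sigma> a ^ 2 + w ^ 2"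
    unfolding trace_form_def using a(1) by (subst of_rat_field_trace) (simp_all add: sigma_simps w_def)
  show "trace_form M ?x = 3 * r ^ 2 + trace_form M a * (s ^ 2 - s * t + t ^ 2)"
    unfolding trace_form_def[of M ?x]
  proof (rule field_trace_eqI)
    show "?x ^ 2 + \<sigma> (?x ^ 2) + \<sigma> (\<sigma> (?x ^ 2))
        = of_rat (3 * r ^ 2 + trace_form M a * (s ^ 2 - s * t + t ^ 2))"
      using hex_form_cyclic_sum[OF w, of "of_rat r" "of_rat s" "of_rat t"]
      unfolding orbit_squares
      by (simp add: of_rat_add of_rat_mult of_rat_diff of_rat_power T)
  qed (use x in auto)
qed

text \<open>
  Twice the discriminant of the minimal polynomial of \<open>a\<close> is \<open>T\<^sup>3 - 54 N\<^sup>2\<close>, where \<open>T\<close> is the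
  trace of \<open>a\<^sup>2\<close> and \<open>N\<close> the norm of \<open>a\<close>; the discriminant is a rational square since the
  group is cyclic, so \<open>T\<^sup>3\<close> is positive.
\<close>

lemma trace_form_pos:
  assumes a: "a \<in> M" "field_trace M a = 0" "a \<noteq> 0"
  shows "trace_form M a > 0"
proof -
  have "a \<notin> \<rat>"
    using a by (auto elim!: Rats_cases simp: field_trace_of_rat)
  note neq = irrational_orbit[OF a(1) this]
  define w where "w = \<sigma> (\<sigma> a)"
  have w: "w = - a - \<sigma> a"
    using of_rat_field_trace[OF a(1)] a(2) by (simp add: w_def algebra_simps eq_neg_iff_add_eq_0)
  \<comment> \<open>A square root of the discriminant and the norm: rotating \<open>a\<close>,
    \<open>\<sigma> a\<close>, \<open>w\<close> leaves both products unchanged.\<close>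
  have "(a - \<sigma> a) * (\<sigma> a - w) * (w - a) \<in> \<rat>" "a * \<sigma> a * w \<in> \<rat>"
    by (rule fixed_imp_Rats; use a in \<open>simp add: sigma_simps w_def sigma_cube\<close>)+
  then obtain D N where DN: "(a - \<sigma> a) * (\<sigma> a - w) * (w - a) = of_rat D" "a * \<sigma> a * w = of_rat N"
    by (auto elim!: Rats_cases)
  have T: "of_rat (trace_form M a) = a ^ 2 + \<sigma> a ^ 2 + w ^ 2"
    unfolding trace_form_def using a(1) by (subst of_rat_field_trace) (simp_all add: sigma_simps w_def)
  have "of_rat (trace_form M a ^ 3) = (a ^ 2 + \<sigma> a ^ 2 + w ^ 2) ^ 3"
    by (simp add: of_rat_power T)
  also have "\<dots> = 2 * ((a - \<sigma> a) * (\<sigma> a - w) * (w - a)) ^ 2 + 54 * (a * \<sigma> a * w) ^ 2"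
    unfolding w by (simp add: power2_eq_square power3_eq_cube algebra_simps)
  also have "\<dots> = of_rat (2 * D ^ 2 + 54 * N ^ 2)"
    unfolding DN by (simp add: of_rat_add of_rat_mult of_rat_power)
  finally have "trace_form M a ^ 3 = 2 * D ^ 2 + 54 * N ^ 2"
    by (simp only: of_rat_eq_iff)
  moreover have "D \<noteq> 0"
    using neq DN(1) by (auto simp: w_def)
  ultimately have "trace_form M a ^ 3 > 0"
    by (simp add: add_pos_nonneg)
  then show ?thesis by (simp add: zero_less_power_eq)
qed

section \<open>The lattice of trace-zero integers\<close>

abbreviation "OM0 \<equiv> trace_zero_integers M"

lemma OM0_iff: "x \<in> OM0 \<longleftrightarrow> x \<in> OM \<and> field_trace M x = 0"
  by (simp add: trace_zero_integers_def)

text \<open>Clearing denominators makes a multiple \<open>y\<close> of an irrational element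
  integral; \<open>y - \<sigma> y\<close> then has trace zero, and it is nonzero because
  \<open>\<sigma>\<close> moves \<open>y\<close>.\<close>

lemma OM0_nontrivial: "\<exists>x\<in>OM0. x \<noteq> 0"
proof -
  obtain x where x: "x \<in> M" "x \<notin> \<rat>"
    using irrational_exists by blast
  obtain p q r where eq: "x ^ 3 = of_rat p + of_rat q * x + of_rat r * x ^ 2"
    using irrational_cubic[OF x] by (metis insertI1)
  obtain n a b c where n: "n > 0" "of_int n * p = of_int a" "of_int n * q = of_int b"
      "of_int n * r = of_int c"
    using rat_common_denominator .
  define y where "y = of_int n * x"
  have n': "of_int n * of_rat p = (of_int a :: 'a)" "of_int n * of_rat q = (of_int b :: 'a)"
      "of_int n * of_rat r = (of_int c :: 'a)"
    using n(2-4) by (metis of_rat_mult of_rat_of_int_eq)+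
  \<comment> \<open>Multiplying the cubic by \<open>N ^ 3\<close> and regrouping leaves
    \<open>P\<close>, \<open>Q\<close>, \<open>R\<close> each with a factor \<open>N\<close>, so
    that \<open>n'\<close> makes every coefficient an integer.\<close>
  have expand: "N ^ 3 * (P + Q * x + R * x ^ 2)
      = N ^ 2 * (N * P) + N * (N * Q) * (N * x) + (N * R) * (N * x) ^ 2" for N P Q R :: 'a
    by (simp add: distrib_left power_mult_distrib power2_eq_square power3_eq_cube mult_ac)
  have "y ^ 3 = of_int n ^ 3 * (of_rat p + of_rat q * x + of_rat r * x ^ 2)"
    by (simp add: y_def power_mult_distrib eq)
  also have "\<dots> = of_int n ^ 2 * (of_int n * of_rat p) + of_int n * (of_int n * of_rat q) * y
      + (of_int n * of_rat r) * y ^ 2"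
    unfolding y_def by (rule expand)
  also have "\<dots> = of_int (n ^ 2 * a) + of_int (n * b) * y + of_int c * y ^ 2"
    unfolding n' by simp
  finally have "algebraic_int y"
    by (rule algebraic_int_cubic)
  then have y: "y \<in> OM"
    using x by (simp add: y_def ring_of_integers_def M_mult)
  have "y - \<sigma> y \<in> OM0"
    using y OM_M[OF y] by (simp add: OM0_iff OM_diff OM_sigma trace_diff trace_sigma)
  moreover have "y - \<sigma> y \<noteq> 0"
    using x n(1) irrational_orbit(1)[OF x] by (simp add: y_def sigma_simps)
  ultimately show ?thesis by blast
qed

text \<open>The trace of a vanishing combination gives \<open>p = 0\<close>; its form value is then
  \<open>trace_form M a\<close> times \<open>q ^ 2 - q * r + r ^ 2\<close>. The first factor is
  positive and the second is definite, so \<open>q\<close> and \<open>r\<close> vanish too.\<close>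

lemma trace_zero_coordinates:
  assumes a: "a \<in> M" "field_trace M a = 0" "a \<noteq> 0"
  shows "of_rat p * 1 + of_rat q * a + of_rat r * \<sigma> a = 0 \<Longrightarrow> p = 0 \<and> q = 0 \<and> r = 0"
    and "x \<in> M \<Longrightarrow> \<exists>p q r. x = of_rat p + of_rat q * a + of_rat r * \<sigma> a"
proof -
  have trivial: "p = 0 \<and> q = 0 \<and> r = 0"
    if "of_rat p * 1 + of_rat q * a + of_rat r * \<sigma> a = 0" for p q r
  proof -
    have eq: "of_rat p + of_rat q * a + of_rat r * \<sigma> a = 0"
      using that by simp
    have "p = 0"
      using trace_square_expand(2)[OF a(1,2), of p q r] unfolding eq by (simp add: trace_0)
    moreover from this have "q ^ 2 - q * r + r ^ 2 = 0"
      using trace_square_expand(3)[OF a(1,2), of p q r] trace_form_pos[OF a] unfolding eq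
      by (simp add: trace_form_def trace_0)
    then have "(q - r / 2) ^ 2 + 3 / 4 * r ^ 2 = 0"
      by (simp add: power2_eq_square field_simps)
    then have "(q - r / 2) ^ 2 = 0 \<and> 3 / 4 * r ^ 2 = 0"
      by (subst (asm) add_nonneg_eq_0_iff) auto
    ultimately show ?thesis by simp
  qed
  then show "of_rat p * 1 + of_rat q * a + of_rat r * \<sigma> a = 0 \<Longrightarrow> p = 0 \<and> q = 0 \<and> r = 0"
    by blast
  show "\<exists>p q r. x = of_rat p + of_rat q * a + of_rat r * \<sigma> a" if x: "x \<in> M"
    using triple_coordinates[OF M_1 a(1) sigma_M[OF a(1)] trivial x] by force
qed

text \<open>
  Division with remainder: the form \<open>s\<^sup>2 - s t + t\<^sup>2\<close> is at most \<open>3 / 4\<close> on the square of radius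
  \<open>1 / 2\<close>, so a shortest nonzero vector and its conjugate generate the trace-zero integers.
\<close>

lemma OM0_generator:
  obtains a where "a \<in> OM0" "a \<noteq> 0"
    "\<And>x. x \<in> OM0 \<Longrightarrow> \<exists>j k. x = of_int j * a + of_int k * \<sigma> a"
proof -
  \<comment> \<open>The form values on nonzero trace-zero integers are positive integers;
    \<open>m\<close> reads them as naturals so that a least one exists.\<close>
  define m where "m x = nat \<lfloor>trace_form M x\<rfloor>" for x
  obtain a where a: "a \<in> OM0" "a \<noteq> 0" and least: "\<And>x. x \<in> OM0 \<Longrightarrow> x \<noteq> 0 \<Longrightarrow> m a \<le> m x"
    using OM0_nontrivial ex_has_least_nat[of "\<lambda>x. x \<in> OM0 \<and> x \<noteq> 0" _ m] by blast
  have m: "of_nat (m x) = trace_form M x" if "x \<in> OM0" "x \<noteq> 0" for x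
  proof -
    have "x ^ 2 \<in> OM"
      using that by (simp add: OM0_iff OM_mult power2_eq_square)
    then obtain k where "trace_form M x = of_int k"
      unfolding trace_form_def by (rule OM_trace_Ints)
    moreover have "trace_form M x > 0"
      using that by (intro trace_form_pos) (auto simp: OM0_iff OM_M)
    ultimately show ?thesis by (simp add: m_def)
  qed
  have aM: "a \<in> M" "field_trace M a = 0"
    using a by (auto simp: OM0_iff OM_M)
  have "\<exists>j k. x = of_int j * a + of_int k * \<sigma> a" if x: "x \<in> OM0" for x
  proof -
    obtain p s t where pst: "x = of_rat p + of_rat s * a + of_rat t * \<sigma> a"
      using trace_zero_coordinates(2)[OF aM a(2)] x by (meson OM0_iff OM_M)
    have "p = 0"
      using trace_square_expand(2)[OF aM, of p s t] x by (simp add: OM0_iff flip: pst)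
    define j k where "j = round s" and "k = round t"
    define u v where "u = s - of_int j" and "v = t - of_int k"
    have uv: "\<bar>u\<bar> \<le> 1 / 2" "\<bar>v\<bar> \<le> 1 / 2"
      using of_int_round_abs_le[of s] of_int_round_abs_le[of t]
      by (simp_all add: u_def v_def j_def k_def abs_minus_commute)
    define z where "z = x - (of_int j * a + of_int k * \<sigma> a)"
    have z: "z = of_rat 0 + of_rat u * a + of_rat v * \<sigma> a"
      using \<open>p = 0\<close> by (simp add: z_def pst u_def v_def of_rat_diff algebra_simps)
    have "z \<in> OM"
      using x a unfolding z_def OM0_iff by (intro OM_diff OM_add OM_mult OM_of_int OM_sigma) auto
    then have z0: "z \<in> OM0"
      using trace_square_expand(2)[OF aM, of 0 u v, folded z] by (simp add: OM0_iff)
    have "z = 0"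
    proof (rule ccontr)
      assume "z \<noteq> 0"
      then have "trace_form M a \<le> trace_form M z"
        using least[of z] m[of z] m[OF a] z0 by (metis of_nat_le_iff)
      also have "trace_form M z = trace_form M a * (u ^ 2 - u * v + v ^ 2)"
        unfolding z using trace_square_expand(3)[OF aM, of 0 u v] by simp
      finally have "1 \<le> u ^ 2 - u * v + v ^ 2"
        using trace_form_pos[OF aM a(2)] by simp
      moreover have "u ^ 2 \<le> 1 / 4" "v ^ 2 \<le> 1 / 4" "\<bar>u * v\<bar> \<le> 1 / 4"
        using uv abs_le_square_iff[of u "1 / 2"] abs_le_square_iff[of v "1 / 2"]
          mult_mono[of "\<bar>u\<bar>" "1 / 2" "\<bar>v\<bar>" "1 / 2"]
        by (simp_all add: power2_eq_square abs_mult)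
      ultimately show False by linarith
    qed
    then show ?thesis
      unfolding z_def by (metis eq_iff_diff_eq_0)
  qed
  with a that show ?thesis by blast
qed

end

text \<open>The automorphisms jointly fix only the rationals, so one of them moves a given
  irrational element.\<close>

lemma galois_cubic_field_cyclic:
  assumes "galois_cubic_field M"
  obtains \<sigma> where "cyclic_cubic M \<sigma>"
proof -
  interpret cubic_subfield M
    using assms by unfold_locales (auto simp: galois_cubic_field_def number_field_def field_degree_def)
  obtain x where x: "x \<in> M" "x \<notin> \<rat>"
    using irrational_exists by blast
  then obtain \<sigma> where "field_aut M \<sigma>" "\<sigma> x \<noteq> x"
    using assms unfolding galois_cubic_field_def galois_over_rat_def by blast
  then have "cyclic_cubic M \<sigma>"
    using x by unfold_locales auto
  then show ?thesis by (rule that)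
qed

section \<open>Discriminant and ring of integers\<close>

text \<open>Laplace expansion along the first column, with the minors written again as
  \<open>mat n n\<close> so that rewriting can iterate; the \<open>if\<close> skips row
  \<open>i\<close>.\<close>

lemma det_mat_Suc:
  fixes f :: "nat \<times> nat \<Rightarrow> 'a::comm_ring_1"
  shows "det (mat (Suc n) (Suc n) f) =
    (\<Sum>i<Suc n. f (i, 0) * ((- 1) ^ i * det (mat n n (\<lambda>(k, l). f (if k < i then k else Suc k, Suc l)))))"
proof -
  have "mat_delete (mat (Suc n) (Suc n) f) i 0 = mat n n (\<lambda>(k, l). f (if k < i then k else Suc k, Suc l))"
    for i
    by (rule eq_matI) (auto simp: mat_delete_def)
  then show ?thesis
    by (subst laplace_expansion_column[of _ "Suc n" 0]) (simp_all add: cofactor_def)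
qed

lemma det_mat_3:
  fixes f :: "nat \<times> nat \<Rightarrow> 'a::comm_ring_1"
  shows "det (mat 3 3 f) = f (0, 0) * (f (1, 1) * f (2, 2) - f (1, 2) * f (2, 1))
    - f (1, 0) * (f (0, 1) * f (2, 2) - f (0, 2) * f (2, 1))
    + f (2, 0) * (f (0, 1) * f (1, 2) - f (0, 2) * f (1, 1))"
  by (simp add: numeral_3_eq_3 numeral_2_eq_2 det_mat_Suc algebra_simps)

context cyclic_cubic
begin

lemma trace_sum:
  assumes "\<And>i. i \<in> S \<Longrightarrow> f i \<in> M"
  shows "field_trace M (sum f S) = (\<Sum>i\<in>S. field_trace M (f i))" "sum f S \<in> M"
  using assms by (induction S rule: infinite_finite_induct) (auto simp: trace_0 trace_add)

definition gram_mat :: "'a list \<Rightarrow> rat mat" where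
  "gram_mat bs = mat (length bs) (length bs) (\<lambda>(i, j). field_trace M (bs ! i * bs ! j))"

text \<open>If the integer matrix \<open>P\<close> expresses \<open>bs\<close> in terms of
  \<open>cs\<close>, the Gram matrix is multiplied by \<open>P\<close> on the left and by its
  transpose on the right; \<open>p\<close> is \<open>det P\<close>.\<close>

lemma gram_mat_change_of_basis:
  assumes bs: "set bs \<subseteq> OM" and cs: "integral_basis M cs" and len: "length bs = length cs"
  obtains p :: int where "det (gram_mat bs) = of_int (p ^ 2) * det (gram_mat cs)"
proof -
  define n where "n = length cs"
  have ind: "int_mod.independent (set cs)" and span: "int_mod.span (set cs) = OM"
    and dist: "distinct cs"
    using cs by (auto simp: integral_basis_def)
  define R where "R i j = int_mod.representation (set cs) (bs ! i) (cs ! j)" for i j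
  have csM: "cs ! j \<in> M" if "j < n" for j
    using that span int_mod.span_base[of "cs ! j" "set cs"] OM_M by (auto simp: n_def)
  have b: "bs ! i = (\<Sum>j<n. of_int (R i j) * cs ! j)" if "i < n" for i
  proof -
    have "bs ! i \<in> int_mod.span (set cs)"
      using that bs len unfolding span by (auto simp: n_def)
    from int_mod.sum_representation_eq[OF ind this finite_set order_refl]
    have "bs ! i = (\<Sum>c\<in>set cs. of_int (int_mod.representation (set cs) (bs ! i) c) * c)"
      by simp
    also have "\<dots> = (\<Sum>j<n. of_int (R i j) * cs ! j)"
      unfolding R_def n_def
      by (rule sum.reindex_bij_betw[symmetric]) (use dist in \<open>auto intro: bij_betw_nth\<close>)
    finally show ?thesis .
  qed
  define P where "P = mat n n (\<lambda>(i, j). R i j)"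
  let ?P = "map_mat of_int P :: rat mat"
  have P: "P \<in> carrier_mat n n" "?P \<in> carrier_mat n n" and G: "gram_mat cs \<in> carrier_mat n n"
    by (simp_all add: P_def gram_mat_def n_def)
  have trace_double_sum: "field_trace M (\<Sum>j<n. \<Sum>k<n. f j k) = (\<Sum>j<n. \<Sum>k<n. field_trace M (f j k))"
    if f: "\<And>j k. j < n \<Longrightarrow> k < n \<Longrightarrow> f j k \<in> M" for f
  proof -
    have "field_trace M (\<Sum>j<n. \<Sum>k<n. f j k) = (\<Sum>j<n. field_trace M (\<Sum>k<n. f j k))"
      by (intro trace_sum) (use f in auto)
    also have "\<dots> = (\<Sum>j<n. \<Sum>k<n. field_trace M (f j k))"
      by (intro sum.cong refl trace_sum(1)) (use f in auto)
    finally show ?thesis .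
  qed
  have P': "transpose_mat ?P \<in> carrier_mat n n"
    using P by simp
  have "gram_mat bs = ?P * gram_mat cs * transpose_mat ?P"
  proof (rule eq_matI)
    fix i l assume "i < dim_row (?P * gram_mat cs * transpose_mat ?P)"
      "l < dim_col (?P * gram_mat cs * transpose_mat ?P)"
    then have il: "i < n" "l < n"
      by (simp_all add: P_def)
    have "bs ! i * bs ! l = (\<Sum>j<n. \<Sum>k<n. of_int (R i j * R l k) * (cs ! j * cs ! k))"
      unfolding b[OF il(1)] b[OF il(2)]
      by (simp add: sum_product mult_ac)
    then have "field_trace M (bs ! i * bs ! l)
        = (\<Sum>j<n. \<Sum>k<n. of_int (R i j * R l k) * field_trace M (cs ! j * cs ! k))"
      using csM by (simp add: trace_double_sum trace_of_int_scale M_mult del: of_int_mult cong: sum.cong_simp)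
    also have "\<dots> = (\<Sum>k<n. \<Sum>j<n. of_int (R i j * R l k) * field_trace M (cs ! j * cs ! k))"
      by (rule sum.swap)
    also have "\<dots> = (\<Sum>k<n. (\<Sum>j<n. of_int (R i j) * field_trace M (cs ! j * cs ! k)) * of_int (R l k))"
      unfolding sum_distrib_right of_int_mult by (intro sum.cong refl) (metis mult.assoc mult.commute)
    finally show "gram_mat bs $$ (i, l) = (?P * gram_mat cs * transpose_mat ?P) $$ (i, l)"
      using il len by (simp add: P_def gram_mat_def n_def scalar_prod_def atLeast0LessThan)
  qed (simp_all add: P_def gram_mat_def n_def len)
  then have "det (gram_mat bs) = det ?P * det (gram_mat cs) * det ?P"
    using det_mult[OF mult_carrier_mat[OF P(2) G] P']
      det_mult[OF P(2) G] det_transpose[OF P(2)] by simp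
  also have "\<dots> = of_int (det P ^ 2) * det (gram_mat cs)"
    by (simp add: of_int_hom.hom_det power2_eq_square)
  finally have "det (gram_mat bs) = of_int (det P ^ 2) * det (gram_mat cs)" .
  then show ?thesis by (rule that)
qed

text \<open>For two integral bases each Gram determinant is an integer square times the other;
  unless they vanish, both squares are \<open>1\<close>.\<close>

lemma field_discriminant_eq:
  assumes cs: "integral_basis M cs"
  shows "field_discriminant M = det (gram_mat cs)"
proof -
  define bs where "bs = (SOME bs. integral_basis M bs)"
  have bs: "integral_basis M bs"
    unfolding bs_def using cs by (rule someI)
  have "card (set bs) = card (set cs)"
    using bs cs by (intro int_mod_card_basis_unique) (auto simp: integral_basis_def)
  then have len: "length bs = length cs"
    using bs cs by (simp add: integral_basis_def distinct_card)
  have sub: "set xs \<subseteq> OM" if "integral_basis M xs" for xs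
    using that int_mod.span_superset[of "set xs"] by (simp add: integral_basis_def)
  obtain p q :: int where p: "det (gram_mat bs) = of_int (p ^ 2) * det (gram_mat cs)"
    and q: "det (gram_mat cs) = of_int (q ^ 2) * det (gram_mat bs)"
    using gram_mat_change_of_basis sub bs cs len by metis
  have "det (gram_mat bs) = det (gram_mat cs)"
  proof (cases "det (gram_mat cs) = 0")
    case False
    have "of_int (p ^ 2 * q ^ 2) * det (gram_mat cs) = det (gram_mat cs)"
      using p q by (metis mult.assoc mult.commute of_int_mult)
    then have "(of_int (p ^ 2 * q ^ 2) :: rat) = 1"
      using False by simp
    then have "p ^ 2 * q ^ 2 = 1"
      by (simp only: of_int_eq_1_iff)
    then have "p ^ 2 = 1"
      using pos_zmult_eq_1_iff_lemma[of "p ^ 2" "q ^ 2"] zero_le_power2[of p] by auto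
    then show ?thesis using p by simp
  qed (use p in simp)
  then show ?thesis
    by (simp add: field_discriminant_def Let_def gram_mat_def bs_def)
qed

text \<open>Polarization of the quadratic formula in \<open>trace_square_expand\<close>.\<close>

lemma trace_product:
  assumes a: "a \<in> M" "field_trace M a = 0"
  shows "field_trace M ((of_rat r + of_rat s * a + of_rat t * \<sigma> a)
      * (of_rat r' + of_rat s' * a + of_rat t' * \<sigma> a))
    = 3 * r * r' + trace_form M a * (s * s' + t * t' - (s * t' + t * s') / 2)"
proof -
  define x y where "x = of_rat r + of_rat s * a + of_rat t * \<sigma> a"
    and "y = of_rat r' + of_rat s' * a + of_rat t' * \<sigma> a"
  have xy: "x + y = of_rat (r + r') + of_rat (s + s') * a + of_rat (t + t') * \<sigma> a"
    by (simp add: x_def y_def of_rat_add algebra_simps)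
  have M: "x \<in> M" "y \<in> M"
    unfolding x_def y_def using trace_square_expand(1)[OF a] by blast+
  have "(x + y) ^ 2 = x ^ 2 + (x * y + x * y) + y ^ 2"
    by (simp add: power2_eq_square algebra_simps)
  then have "trace_form M (x + y)
      = trace_form M x + (field_trace M (x * y) + field_trace M (x * y)) + trace_form M y"
    using M by (simp only: trace_form_def trace_add M_add M_mult M_power)
  then show ?thesis
    unfolding xy unfolding x_def y_def trace_square_expand(3)[OF a]
    by (simp add: power2_eq_square field_simps)
qed

section \<open>The ring of integers as an extension of the trace-zero lattice\<close>

lemma OM0_scale: "x \<in> OM0 \<Longrightarrow> of_int k * x \<in> OM0"
  and OM0_add: "x \<in> OM0 \<Longrightarrow> y \<in> OM0 \<Longrightarrow> x + y \<in> OM0"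
  and OM0_sigma: "x \<in> OM0 \<Longrightarrow> \<sigma> x \<in> OM0"
  by (simp_all add: OM0_iff OM_mult OM_of_int OM_add OM_sigma trace_of_int_scale trace_add
      trace_sigma OM_M)

text \<open>
  If some integer \<open>b\<close> has trace \<open>1\<close>, comparing \<open>\<sigma> b - b\<close> with the generators shows that \<open>b\<close> is
  \<open>1 / 3 + n (a - \<sigma> a) / 3\<close> up to an element of \<open>OM0\<close>; here \<open>n\<close> is prime to \<open>3\<close> because
  \<open>1 / 3\<close> is not integral, and the sign of \<open>a\<close> can be chosen so that \<open>n = 1\<close>.
\<close>

lemma trace_one_element:
  assumes a: "a \<in> OM0" "a \<noteq> 0" and gen: "\<And>x. x \<in> OM0 \<Longrightarrow> \<exists>j k. x = of_int j * a + of_int k * \<sigma> a"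
    and b: "b \<in> OM" "field_trace M b = 1"
  obtains e :: int where "e = 1 \<or> e = - 1"
    "of_rat (1 / 3) + of_rat (of_int e / 3) * a - of_rat (of_int e / 3) * \<sigma> a \<in> OM"
proof -
  have aM: "a \<in> M" "field_trace M a = 0" and aO: "a \<in> OM" "\<sigma> a \<in> OM"
    using a by (auto simp: OM0_iff OM_M OM_sigma)
  obtain p s t where b_eq: "b = of_rat p + of_rat s * a + of_rat t * \<sigma> a"
    using trace_zero_coordinates(2)[OF aM a(2)] OM_M[OF b(1)] by blast
  have p: "p = 1 / 3"
    using trace_square_expand(2)[OF aM, of p s t, folded b_eq] b(2) by simp
  have "\<sigma> b - b \<in> OM0"
    using b OM_M[OF b(1)] by (simp add: OM0_iff OM_diff OM_sigma trace_diff trace_sigma)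
  then obtain j k where jk: "\<sigma> b - b = of_int j * a + of_int k * \<sigma> a"
    using gen by blast
  have ssa: "\<sigma> (\<sigma> a) = - a - \<sigma> a"
    using of_rat_field_trace[OF aM(1)] aM(2) by (simp add: algebra_simps eq_neg_iff_add_eq_0)
  have "\<sigma> b - b = of_rat (- t - s) * a + of_rat (s - 2 * t) * \<sigma> a"
    unfolding b_eq using aM
    by (simp add: sigma_simps ssa of_rat_diff of_rat_minus of_rat_mult algebra_simps)
  with jk have diff: "of_rat (- t - s) * a + of_rat (s - 2 * t) * \<sigma> a - (of_int j * a + of_int k * \<sigma> a) = 0"
    by simp
  have split: "of_rat (u - of_int i) = of_rat u - (of_int i :: 'a)" for u i
    by (simp only: of_rat_diff of_rat_of_int_eq)
  have collect: "of_rat 0 * 1 + (P - J) * a + (Q - K) * c = 0"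
    if "P * a + Q * c - (J * a + K * c) = 0" for P J Q K c
    using that by (simp add: algebra_simps)
  have "of_rat 0 * 1 + of_rat (- t - s - of_int j) * a + of_rat (s - 2 * t - of_int k) * \<sigma> a = 0"
    unfolding split by (rule collect[OF diff])
  then have st: "- t - s - of_int j = 0" "s - 2 * t - of_int k = 0"
    using trace_zero_coordinates(1)[OF aM a(2)] by blast+
  \<comment> \<open>Adding the two equations of \<open>st\<close> gives
    \<open>3 * t = - (j + k)\<close>.\<close>
  define n where "n = j + k"
  have t: "t = - of_int n / 3" and s: "s = of_int n / 3 - of_int j"
    using st by (simp_all add: n_def field_simps)
  \<comment> \<open>\<open>l\<close> is the integer nearest to \<open>n / 3\<close>, so that the
    remainder \<open>e\<close> is \<open>-1\<close>, \<open>0\<close> or \<open>1\<close>.\<close>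
  define l where "l = (n + 1) div 3"
  define e where "e = n - 3 * l"
  have e: "e = 0 \<or> e = 1 \<or> e = - 1"
    unfolding e_def l_def by presburger
  have n: "(of_int n :: rat) = of_int e + 3 * of_int l"
    by (simp add: e_def)
  define c where "c = of_rat (1 / 3) + of_rat (of_int e / 3) * a - of_rat (of_int e / 3) * \<sigma> a"
  have "c = b + of_int (j - l) * a + of_int l * \<sigma> a"
    unfolding c_def b_eq p s t n
    by (simp add: of_rat_diff of_rat_add of_rat_divide of_rat_mult of_rat_minus field_simps)
  also have "\<dots> \<in> OM"
    using b(1) aO by (intro OM_add OM_mult OM_of_int)
  finally have c: "c \<in> OM" .
  have "e \<noteq> 0"
  proof
    assume "e = 0"
    then have "c = of_rat (1 / 3)"
      by (simp add: c_def)
    \<comment> \<open>The trace of \<open>1 / 3\<close> is \<open>1\<close>, which is no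
      contradiction; the trace of its square is \<open>1 / 3\<close>.\<close>
    then have "c * c = of_rat (1 / 9)"
      by (simp flip: of_rat_mult)
    moreover obtain k where "field_trace M (c * c) = of_int k"
      using OM_trace_Ints[OF OM_mult[OF c c]] by blast
    ultimately have "of_int (3 * k) = (1 :: rat)"
      by (simp add: field_trace_of_rat)
    then have "3 * k = 1"
      by (simp only: of_int_eq_1_iff)
    then show False by presburger
  qed
  with e c show ?thesis
    using that[of e] by (auto simp: c_def)
qed

text \<open>\<open>OM\<close> is \<open>OM0\<close> plus the multiples of one element whose trace
  generates the traces of all integers: \<open>1\<close>, of trace \<open>3\<close>, or an element
  of trace \<open>1\<close>. Writing it with \<open>\<beta>\<close> and \<open>\<gamma>\<close> lets
  one discriminant computation cover both cases.\<close>

lemma integers_structure: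
  obtains a \<beta> \<gamma> where "a \<in> OM0" "a \<noteq> 0"
    "(\<beta>, \<gamma>) = (1, 0) \<or> (\<beta>, \<gamma>) = (1 / 3, 1 / 3)"
    "OM0 = {of_int j * a + of_int k * \<sigma> a | j k. True}"
    "OM = {of_int i * (of_rat \<beta> + of_rat \<gamma> * a - of_rat \<gamma> * \<sigma> a) + of_int j * a + of_int k * \<sigma> a | i j k. True}"
proof -
  obtain a where a: "a \<in> OM0" "a \<noteq> 0"
    and gen: "\<And>x. x \<in> OM0 \<Longrightarrow> \<exists>j k. x = of_int j * a + of_int k * \<sigma> a"
    using OM0_generator by blast
  \<comment> \<open>Both signs are prepared, since the sign of the generator is fixed only in the
    second case below.\<close>
  have OM0_eq: "OM0 = {of_int j * a' + of_int k * \<sigma> a' | j k. True}" if "a' = a \<or> a' = - a" for a'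
  proof (intro equalityI subsetI)
    fix x assume "x \<in> OM0"
    then obtain j k where "x = of_int j * a + of_int k * \<sigma> a"
      using gen by blast
    then have "x = of_int j * a + of_int k * \<sigma> a" "x = of_int (- j) * (- a) + of_int (- k) * \<sigma> (- a)"
      using a by (simp_all add: sigma_minus OM0_iff OM_M)
    then show "x \<in> {of_int j * a' + of_int k * \<sigma> a' | j k. True}"
      using that by blast
  next
    fix x assume "x \<in> {of_int j * a' + of_int k * \<sigma> a' | j k. True}"
    moreover have "a' \<in> OM0"
      using that a OM0_scale[of a "- 1"] by auto
    ultimately show "x \<in> OM0"
      by (auto intro: OM0_add OM0_scale OM0_sigma)
  qed
  have OM_eq: "OM = {of_int i * b + of_int j * a' + of_int k * \<sigma> a' | i j k. True}"
    if b: "b \<in> OM" and a': "a' = a \<or> a' = - a"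
      and tr: "\<And>x. x \<in> OM \<Longrightarrow> \<exists>i. field_trace M x = of_int i * field_trace M b" for a' b
  proof (intro equalityI subsetI)
    fix x assume x: "x \<in> OM"
    then obtain i where "field_trace M x = of_int i * field_trace M b"
      using tr by blast
    then have "x - of_int i * b \<in> OM0"
      using x b by (simp add: OM0_iff OM_diff OM_mult OM_of_int trace_diff trace_of_int_scale OM_M M_mult)
    then obtain j k where "x - of_int i * b = of_int j * a' + of_int k * \<sigma> a'"
      using OM0_eq[OF a'] by blast
    then have "x = of_int i * b + of_int j * a' + of_int k * \<sigma> a'"
      by (simp add: algebra_simps)
    then show "x \<in> {of_int i * b + of_int j * a' + of_int k * \<sigma> a' | i j k. True}"
      by blast
  next
    fix x assume "x \<in> {of_int i * b + of_int j * a' + of_int k * \<sigma> a' | i j k. True}"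
    moreover have "a' \<in> OM"
      using a' a OM0_scale[of a "- 1"] by (auto simp: OM0_iff)
    ultimately show "x \<in> OM"
      using b by (auto intro!: OM_add OM_mult OM_of_int OM_sigma)
  qed
  show ?thesis
  proof (cases "\<forall>x\<in>OM. \<exists>k. field_trace M x = 3 * of_int k")
    case True
    have "OM = {of_int i * 1 + of_int j * a + of_int k * \<sigma> a | i j k. True}"
      using True OM_of_int[of 1] trace_of_int[of 1] by (intro OM_eq) (auto simp: mult.commute)
    then show ?thesis
      using a OM0_eq[of a] by (intro that[of a 1 0]) auto
  next
    case False
    then obtain x where x: "x \<in> OM" and x3: "\<And>k. field_trace M x \<noteq> 3 * of_int k"
      by blast
    obtain m where m: "field_trace M x = of_int m"
      using OM_trace_Ints[OF x] .
    have "\<exists>k. m = 3 * k \<or> m = 3 * k + 1 \<or> m = 3 * k - 1"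
      by presburger
    then obtain k where k: "m = 3 * k \<or> m = 3 * k + 1 \<or> m = 3 * k - 1" ..
    have "m \<noteq> 3 * k"
      using x3[of k] m by auto
    \<comment> \<open>Subtracting the integer \<open>k\<close> lowers the trace by
      \<open>3 * k\<close> and leaves \<open>1\<close> or \<open>-1\<close>.\<close>
    with k have "x - of_int k \<in> OM \<and> field_trace M (x - of_int k) = 1
        \<or> of_int k - x \<in> OM \<and> field_trace M (of_int k - x) = 1"
      using x m by (auto simp: OM_diff OM_of_int trace_diff trace_of_int OM_M)
    then obtain b where b: "b \<in> OM" "field_trace M b = 1"
      by blast
    obtain e :: int where e: "e = 1 \<or> e = - 1"
      and c: "of_rat (1 / 3) + of_rat (of_int e / 3) * a - of_rat (of_int e / 3) * \<sigma> a \<in> OM"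
      using trace_one_element[OF a gen b] by blast
    \<comment> \<open>The sign \<open>e\<close> is absorbed into the generator.\<close>
    define a' where "a' = of_int e * a"
    have a': "a' = a \<or> a' = - a" "a' \<in> OM0" "a' \<noteq> 0"
      using e a OM0_scale[of a e] by (auto simp: a'_def)
    have sa': "\<sigma> a' = of_int e * \<sigma> a"
      using a by (simp add: a'_def sigma_mult OM0_iff OM_M)
    define c' where "c' = of_rat (1 / 3) + of_rat (1 / 3) * a' - of_rat (1 / 3) * \<sigma> a'"
    have c'_OM: "c' \<in> OM"
      using c unfolding c'_def sa' unfolding a'_def by (simp add: of_rat_divide)
    have "field_trace M c' = 1"
      using trace_square_expand(2)[of a' "1 / 3" "1 / 3" "- 1 / 3"] a'(2)
      by (simp add: c'_def OM0_iff OM_M of_rat_minus)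
    then have "\<exists>i. field_trace M x = of_int i * field_trace M c'" if "x \<in> OM" for x
      using OM_trace_Ints[OF that] by (metis mult.right_neutral)
    then have "OM = {of_int i * c' + of_int j * a' + of_int k * \<sigma> a' | i j k. True}"
      by (rule OM_eq[OF c'_OM a'(1)])
    then show ?thesis
      using a' OM0_eq[of a'] unfolding c'_def by (intro that[of a' "1 / 3" "1 / 3"]) auto
  qed
qed

text \<open>The part of the first basis element involving \<open>\<gamma>\<close> is a rational
  combination of \<open>a\<close> and \<open>\<sigma> a\<close>, so it drops out of the Gram
  determinant, which is \<open>3 * \<beta> ^ 2\<close> times
  \<open>3 / 4 * trace_form M a ^ 2\<close>.\<close>

lemma discriminant_trace_form:
  assumes a: "a \<in> M" "field_trace M a = 0" "a \<noteq> 0" and \<beta>: "\<beta> \<noteq> 0"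
    and OM: "OM = {of_int i * (of_rat \<beta> + of_rat \<gamma> * a - of_rat \<gamma> * \<sigma> a) + of_int j * a + of_int k * \<sigma> a
      | i j k. True}"
  shows "field_discriminant M = 9 / 4 * \<beta> ^ 2 * trace_form M a ^ 2"
proof -
  define b where "b = of_rat \<beta> + of_rat \<gamma> * a - of_rat \<gamma> * \<sigma> a"
  define v where "v = (\<lambda>(r, s, t). of_rat r + of_rat s * a + of_rat t * \<sigma> a)"
  have v: "b = v (\<beta>, \<gamma>, - \<gamma>)" "a = v (0, 1, 0)" "\<sigma> a = v (0, 0, 1)"
    by (simp_all add: v_def b_def of_rat_minus)
  note tr = trace_product[OF a(1,2)]
  have trivial: "p = 0 \<and> q = 0 \<and> r = 0"
    if "of_int p * b + of_int q * a + of_int r * \<sigma> a = 0" for p q r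
  proof -
    have "of_rat (of_int p * \<beta>) * 1 + of_rat (of_int p * \<gamma> + of_int q) * a
        + of_rat (of_int r - of_int p * \<gamma>) * \<sigma> a = 0"
      using that by (simp add: b_def of_rat_add of_rat_diff of_rat_mult algebra_simps)
    from trace_zero_coordinates(1)[OF a this] \<beta> show ?thesis by auto
  qed
  note ind = int_mod.independent_triple[of b a "\<sigma> a", OF trivial]
  have "integral_basis M [b, a, \<sigma> a]"
    using ind unfolding integral_basis_def OM b_def[symmetric]
    by (simp add: set_eq_iff int_mod.span_triple)
  then have "field_discriminant M = det (gram_mat [b, a, \<sigma> a])"
    by (rule field_discriminant_eq)
  also have "\<dots> = 9 / 4 * \<beta> ^ 2 * trace_form M a ^ 2"
  proof -
    define T where "T = trace_form M a"
    have basis: "[b, a, \<sigma> a] = map v [(\<beta>, \<gamma>, - \<gamma>), (0, 1, 0), (0, 0, 1)]" (is "_ = map v ?cs")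
      by (simp only: list.map v[symmetric])
    define g where "g i j = field_trace M (map v ?cs ! i * map v ?cs ! j)" for i j
    have gram: "gram_mat (map v ?cs) = mat 3 3 (\<lambda>(i, j). g i j)"
      by (simp add: gram_mat_def g_def numeral_3_eq_3)
    have trv: "field_trace M (v (r, s, t) * v (r', s', t'))
        = 3 * r * r' + T * (s * s' + t * t' - (s * t' + t * s') / 2)" for r s t r' s' t'
      using tr by (simp add: v_def T_def)
    have g: "g 0 0 = 3 * \<beta> ^ 2 + 3 * T * \<gamma> ^ 2" "g 0 1 = 3 / 2 * T * \<gamma>" "g 0 2 = - (3 / 2 * T * \<gamma>)"
        "g 1 0 = 3 / 2 * T * \<gamma>" "g 1 1 = T" "g 1 2 = - (T / 2)"
        "g 2 0 = - (3 / 2 * T * \<gamma>)" "g 2 1 = - (T / 2)" "g 2 2 = T"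
      unfolding g_def by (simp_all add: trv, simp_all add: power2_eq_square field_simps)
    have "det (gram_mat (map v ?cs)) = 9 / 4 * \<beta> ^ 2 * T ^ 2"
      unfolding gram det_mat_3 prod.case g by (simp add: power2_eq_square field_simps)
    then show ?thesis
      unfolding basis T_def .
  qed
  finally show ?thesis .
qed

end

text \<open>
  Coordinates with respect to \<open>1\<close>, \<open>a\<close> and \<open>\<sigma> a\<close>: the lattices and the form below depend only
  on \<open>d\<close>, so that they are shared by all fields of discriminant \<open>d\<^sup>2\<close>.
\<close>

definition coord_map :: "'a::field_char_0 \<Rightarrow> 'a \<Rightarrow> rat \<times> rat \<times> rat \<Rightarrow> 'a" where
  "coord_map a a' = (\<lambda>(r, s, t). of_rat r + of_rat s * a + of_rat t * a')"

text \<open>The second set holds the coordinates of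
  \<open>i * (1 + a - \<sigma> a) / 3 + j * a + k * \<sigma> a\<close>.\<close>

definition integer_coords :: "nat \<Rightarrow> (rat \<times> rat \<times> rat) set" where
  "integer_coords d = (if 3 dvd d
     then {(of_int i, of_int j, of_int k) | i j k. True}
     else {(of_int i / 3, of_int i / 3 + of_int j, of_int k - of_int i / 3) | i j k. True})"

definition trace_zero_coords :: "(rat \<times> rat \<times> rat) set" where
  "trace_zero_coords = {(0, of_int j, of_int k) | j k. True}"

definition form_scale :: "nat \<Rightarrow> rat" where
  "form_scale d = (if \<not> 3 dvd d then 2 * of_nat d else 2 * of_nat d / 3)"

definition coord_form :: "nat \<Rightarrow> rat \<times> rat \<times> rat \<Rightarrow> rat" where
  "coord_form d = (\<lambda>(r, s, t). 3 * r ^ 2 + form_scale d * (s ^ 2 - s * t + t ^ 2))"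

lemma trace_zero_coords_add:
  "x \<in> trace_zero_coords \<Longrightarrow> y \<in> trace_zero_coords \<Longrightarrow> x + y \<in> trace_zero_coords"
  by (auto simp: trace_zero_coords_def simp flip: of_int_add)

lemma integer_coords_add:
  assumes "x \<in> integer_coords d" "y \<in> integer_coords d"
  shows "x + y \<in> integer_coords d"
proof (cases "3 dvd d")
  case True
  with assms show ?thesis
    by (auto simp: integer_coords_def simp flip: of_int_add)
next
  case False
  with assms obtain i j k i' j' k'
    where "x = (of_int i / 3, of_int i / 3 + of_int j, of_int k - of_int i / 3)"
      "y = (of_int i' / 3, of_int i' / 3 + of_int j', of_int k' - of_int i' / 3)"
    by (auto simp: integer_coords_def)
  then have "x + y = (of_int (i + i') / 3, of_int (i + i') / 3 + of_int (j + j'),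
      of_int (k + k') - of_int (i + i') / 3)"
    by (simp add: add_divide_distrib)
  with False show ?thesis
    unfolding integer_coords_def by (simp only: if_False) blast
qed

section \<open>Coordinates of a field determined by its discriminant\<close>

context cyclic_cubic
begin

lemma inj_coord_map:
  assumes a: "a \<in> M" "field_trace M a = 0" "a \<noteq> 0"
  shows "inj (coord_map a (\<sigma> a))"
proof (rule injI)
  fix x y :: "rat \<times> rat \<times> rat"
  assume eq: "coord_map a (\<sigma> a) x = coord_map a (\<sigma> a) y"
  obtain r s t r' s' t' where xy: "x = (r, s, t)" "y = (r', s', t')"
    by (metis prod_cases3)
  have "of_rat (r - r') * 1 + of_rat (s - s') * a + of_rat (t - t') * \<sigma> a = 0"
    using eq by (simp add: xy coord_map_def of_rat_diff algebra_simps)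
  from trace_zero_coordinates(1)[OF a this] show "x = y"
    by (simp add: xy)
qed

text \<open>The trace of \<open>a * \<sigma> a\<close>, an integer, is minus half of
  \<open>trace_form M a\<close>.\<close>

lemma trace_form_even:
  assumes "a \<in> OM0"
  obtains c where "trace_form M a = 2 * of_int c"
proof -
  have a: "a \<in> M" "field_trace M a = 0" "a \<in> OM"
    using assms by (auto simp: OM0_iff OM_M)
  obtain k where "field_trace M (a * \<sigma> a) = of_int k"
    using OM_trace_Ints[OF OM_mult[OF a(3) OM_sigma[OF a(3)]]] .
  moreover have "field_trace M (a * \<sigma> a) = - trace_form M a / 2"
    using trace_product[OF a(1,2), of 0 1 0 0 0 1] by simp
  ultimately have "trace_form M a = 2 * of_int (- k)"
    by (simp add: field_simps)
  then show ?thesis by (rule that)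
qed

lemma standard_coordinates:
  assumes d: "d > 0" and disc: "field_discriminant M = of_nat (d ^ 2)"
  obtains a where "a \<in> M" "field_trace M a = 0" "a \<noteq> 0" "trace_form M a = form_scale d"
    "OM0 = coord_map a (\<sigma> a) ` trace_zero_coords" "OM = coord_map a (\<sigma> a) ` integer_coords d"
proof -
  obtain a \<beta> \<gamma> where aO: "a \<in> OM0" and a0: "a \<noteq> 0"
    and \<beta>: "(\<beta>, \<gamma>) = (1, 0) \<or> (\<beta>, \<gamma>) = (1 / 3, 1 / 3)"
    and OM0: "OM0 = {of_int j * a + of_int k * \<sigma> a | j k. True}"
    and OM: "OM = {of_int i * (of_rat \<beta> + of_rat \<gamma> * a - of_rat \<gamma> * \<sigma> a) + of_int j * a + of_int k * \<sigma> a
      | i j k. True}"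
    using integers_structure .
  have a: "a \<in> M" "field_trace M a = 0"
    using aO by (auto simp: OM0_iff OM_M)
  note pos = trace_form_pos[OF a a0]
  obtain c where c: "trace_form M a = 2 * of_int c"
    using trace_form_even[OF aO] .
  have "\<beta> > 0" using \<beta> by auto
  have "(3 / 2 * \<beta> * trace_form M a) ^ 2 = (of_nat d) ^ 2"
    using discriminant_trace_form[OF a a0 _ OM] \<open>\<beta> > 0\<close> disc
    by (simp add: power_mult_distrib power_divide)
  \<comment> \<open>Both sides are nonnegative, so the square root of the discriminant formula can
    be taken.\<close>
  then have dT: "3 / 2 * \<beta> * trace_form M a = of_nat d"
    by (rule power2_eq_imp_eq) (use pos \<open>\<beta> > 0\<close> in auto)
  \<comment> \<open>For \<open>\<beta> = 1\<close>, \<open>dT\<close> reads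
    \<open>d = 3 * c\<close>. For \<open>\<beta> = 1 / 3\<close> it reads \<open>d = c\<close>, and
    the extra basis element has form value \<open>(1 + 2 * c) / 3\<close>, whose integrality rules
    out \<open>3 dvd c\<close>.\<close>
  have three_dvd: "3 dvd d \<longleftrightarrow> \<beta> = 1"
  proof
    assume "\<beta> = 1"
    then have "(of_int (int d) :: rat) = of_int (3 * c)"
      using dT c by simp
    then have "int d = 3 * c"
      by (simp only: of_int_eq_iff)
    then show "3 dvd d" by presburger
  next
    assume "3 dvd d"
    show "\<beta> = 1"
    proof (rule ccontr)
      assume "\<beta> \<noteq> 1"
      with \<beta> have 3: "\<beta> = 1 / 3" "\<gamma> = 1 / 3" by auto
      have "(of_int (int d) :: rat) = of_int c"
        using dT c 3 by simp
      then have "int d = c"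
        by (simp only: of_int_eq_iff)
      let ?b = "of_rat (1 / 3) + of_rat (1 / 3) * a + of_rat (- 1 / 3) * \<sigma> a"
      have "?b = of_int 1 * (of_rat \<beta> + of_rat \<gamma> * a - of_rat \<gamma> * \<sigma> a) + of_int 0 * a + of_int 0 * \<sigma> a"
        by (simp add: 3 of_rat_minus)
      then have "?b \<in> OM"
        unfolding OM by blast
      then obtain k where "trace_form M ?b = of_int k"
        using OM_trace_Ints[OF OM_mult] unfolding trace_form_def power2_eq_square by blast
      then have "of_int (1 + 2 * c) = (of_int (3 * k) :: rat)"
        using trace_square_expand(3)[OF a, of "1 / 3" "1 / 3" "- 1 / 3"] c
        by (simp add: power2_eq_square field_simps)
      then have "1 + 2 * c = 3 * k"
        by (simp only: of_int_eq_iff)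
      with \<open>int d = c\<close> \<open>3 dvd d\<close> show False by presburger
    qed
  qed
  have "trace_form M a = form_scale d"
  proof (cases "3 dvd d")
    case True
    with three_dvd dT show ?thesis by (simp add: form_scale_def)
  next
    case False
    with \<beta> three_dvd have "\<beta> = 1 / 3" by auto
    with False dT show ?thesis by (simp add: form_scale_def)
  qed
  moreover have "OM0 = coord_map a (\<sigma> a) ` trace_zero_coords"
    unfolding OM0 trace_zero_coords_def by (force simp: coord_map_def image_iff)
  moreover have "OM = coord_map a (\<sigma> a) ` integer_coords d"
  proof (cases "3 dvd d")
    case True
    then have "\<beta> = 1" "\<gamma> = 0" using \<beta> three_dvd by auto
    then show ?thesis
      using True unfolding OM integer_coords_def by (force simp: coord_map_def image_iff)
  next
    case False
    then have 3: "\<beta> = 1 / 3" "\<gamma> = 1 / 3" using \<beta> three_dvd by auto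
    have third: "of_rat (of_int i / 3) = (of_int i * of_rat (1 / 3) :: 'a)" for i
      by (simp add: of_rat_divide)
    have key: "coord_map a (\<sigma> a) (of_int i / 3, of_int i / 3 + of_int j, of_int k - of_int i / 3)
        = of_int i * (of_rat \<beta> + of_rat \<gamma> * a - of_rat \<gamma> * \<sigma> a) + of_int j * a + of_int k * \<sigma> a" for i j k
      unfolding 3 coord_map_def prod.case of_rat_add of_rat_diff of_rat_of_int_eq third
      by (simp add: algebra_simps)
    have "coord_map a (\<sigma> a) ` integer_coords d
        = {coord_map a (\<sigma> a) (of_int i / 3, of_int i / 3 + of_int j, of_int k - of_int i / 3) | i j k. True}"
      unfolding integer_coords_def if_not_P[OF False] by blast
    then show ?thesis
      unfolding OM key by simp
  qed
  ultimately show ?thesis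
    by (rule that[OF a a0])
qed

end

text \<open>One chart \<open>\<phi>\<close> serves both lattices, so that passing from one field to
  the other by charts gives an isometry of the rings of integers that restricts to the trace-zero
  parts.\<close>

lemma galois_cubic_coordinates:
  fixes M :: "'a::field_char_0 set"
  assumes "galois_cubic_field M" "d > 0" "field_discriminant M = of_nat (d ^ 2)"
  obtains \<phi> where "inj \<phi>"
    "quad_isometry trace_zero_coords (coord_form d) (trace_zero_integers M) (trace_form M) \<phi>"
    "quad_isometry (integer_coords d) (coord_form d) (ring_of_integers M) (trace_form M) \<phi>"
proof -
  obtain \<sigma> where "cyclic_cubic M \<sigma>"
    using galois_cubic_field_cyclic[OF assms(1)] .
  then interpret cyclic_cubic M \<sigma> .
  obtain a where a: "a \<in> M" "field_trace M a = 0" "a \<noteq> 0" and T: "trace_form M a = form_scale d"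
    and im: "OM0 = coord_map a (\<sigma> a) ` trace_zero_coords" "OM = coord_map a (\<sigma> a) ` integer_coords d"
    using standard_coordinates[OF assms(2,3)] .
  have inj: "inj (coord_map a (\<sigma> a))"
    using inj_coord_map[OF a] .
  have add: "coord_map a (\<sigma> a) (x + y) = coord_map a (\<sigma> a) x + coord_map a (\<sigma> a) y" for x y
    by (cases x; cases y) (simp add: coord_map_def of_rat_add algebra_simps)
  have form: "trace_form M (coord_map a (\<sigma> a) x) = coord_form d x" for x
    using trace_square_expand(3)[OF a(1,2)] T by (cases x) (simp add: coord_map_def coord_form_def)
  show ?thesis
    by (rule that[OF inj])
      (use im add form inj in \<open>auto simp: quad_isometry_def bij_betw_def intro: inj_on_subset\<close>)
qed

section \<open>Isometries\<close>

lemma quad_isometry_inverse: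
  assumes f: "quad_isometry A q B q' f" and g: "\<And>x. x \<in> A \<Longrightarrow> g (f x) = x"
    and A: "\<And>x y. x \<in> A \<Longrightarrow> y \<in> A \<Longrightarrow> x + y \<in> A"
  shows "quad_isometry B q' A q g"
  unfolding quad_isometry_def
proof (intro conjI ballI)
  have im: "B = f ` A" and inj: "inj_on f A"
    using f by (auto simp: quad_isometry_def bij_betw_def)
  show "bij_betw g B A"
    unfolding im by (rule bij_betw_byWitness[of _ f]) (use g in auto)
  show "q (g y) = q' y" if "y \<in> B" for y
    using that f g unfolding im quad_isometry_def by auto
  show "g (x + y) = g x + g y" if "x \<in> B" "y \<in> B" for x y
  proof -
    obtain u v where uv: "u \<in> A" "v \<in> A" "x = f u" "y = f v"
      using \<open>x \<in> B\<close> \<open>y \<in> B\<close> unfolding im by blast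
    \<comment> \<open>Since \<open>u + v\<close> stays in \<open>A\<close>, \<open>g\<close> inverts
      \<open>f\<close> there.\<close>
    then have "x + y = f (u + v)"
      using f by (simp add: quad_isometry_def)
    then show ?thesis
      using uv g A by simp
  qed
qed

lemma quad_isometry_compose:
  assumes "quad_isometry A q B q' f" "quad_isometry B q' C q'' g"
  shows "quad_isometry A q C q'' (g \<circ> f)"
  using assms bij_betw_trans[of f A B g C] bij_betwE[of f A B]
  by (auto simp: quad_isometry_def)

text \<open>The sign on the second coordinate turns \<open>s ^ 2 - s * t + t ^ 2\<close> into
  \<open>x ^ 2 + x * y + y ^ 2\<close>.\<close>

lemma hex_form_coordinates:
  "quad_isometry UNIV (hex_form (form_scale d)) trace_zero_coords (coord_form d)
    (\<lambda>(x, y). (0, of_int x, - of_int y))"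
  unfolding quad_isometry_def
proof (intro conjI ballI)
  show "bij_betw (\<lambda>(x, y). (0 :: rat, of_int x :: rat, - of_int y :: rat)) UNIV trace_zero_coords"
  proof (rule bij_betw_imageI)
    show "range (\<lambda>(x, y). (0 :: rat, of_int x :: rat, - of_int y :: rat)) = trace_zero_coords"
    proof (intro equalityI subsetI)
      fix z :: "rat \<times> rat \<times> rat"
      assume "z \<in> trace_zero_coords"
      then obtain j k where "z = (0, of_int j, of_int k)"
        by (auto simp: trace_zero_coords_def)
      then have "z = (\<lambda>(x, y). (0, of_int x, - of_int y)) (j, - k)"
        by simp
      then show "z \<in> range (\<lambda>(x, y). (0, of_int x, - of_int y))"
        by blast
    qed (auto simp: trace_zero_coords_def simp flip: of_int_minus)
  qed (auto intro: injI)
next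
  fix x y :: "int \<times> int"
  show "(\<lambda>(x, y). (0 :: rat, of_int x :: rat, - of_int y :: rat)) (x + y)
      = (\<lambda>(x, y). (0, of_int x, - of_int y)) x + (\<lambda>(x, y). (0, of_int x, - of_int y)) y"
    by (cases x; cases y) simp
  show "coord_form d ((\<lambda>(x, y). (0, of_int x, - of_int y)) x) = hex_form (form_scale d) x"
    by (cases x) (simp add: hex_form_def coord_form_def)
qed

theorem theorem3p1:
  fixes K :: "'a::field_char_0 set" and L :: "'b::field_char_0 set" and d :: nat
  assumes "galois_cubic_field K" and "galois_cubic_field L"
    and "d > 0"
    and "field_discriminant K = of_nat (d ^ 2)"
    and "field_discriminant L = of_nat (d ^ 2)"
  shows "quad_isomorphic (trace_zero_integers K) (trace_form K)
           (trace_zero_integers L) (trace_form L) \<and>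
         quad_isomorphic (trace_zero_integers L) (trace_form L) UNIV
           (hex_form (if \<not> 3 dvd d then 2 * of_nat d else 2 * of_nat d / 3)) \<and>
         (\<exists>f g. quad_isometry (trace_zero_integers K) (trace_form K)
                  (trace_zero_integers L) (trace_form L) f \<and>
                quad_isometry (ring_of_integers K) (trace_form K)
                  (ring_of_integers L) (trace_form L) g \<and>
                (\<forall>x\<in>trace_zero_integers K. g x = f x))"
proof -
  obtain \<phi> where \<phi>: "inj \<phi>"
    "quad_isometry trace_zero_coords (coord_form d) (trace_zero_integers K) (trace_form K) \<phi>"
    "quad_isometry (integer_coords d) (coord_form d) (ring_of_integers K) (trace_form K) \<phi>"
    using galois_cubic_coordinates[OF assms(1,3,4)] .
  obtain \<psi> where \<psi>: "inj \<psi>"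
    "quad_isometry trace_zero_coords (coord_form d) (trace_zero_integers L) (trace_form L) \<psi>"
    "quad_isometry (integer_coords d) (coord_form d) (ring_of_integers L) (trace_form L) \<psi>"
    using galois_cubic_coordinates[OF assms(2,3,5)] .
  \<comment> \<open>The chart of \<open>K\<close> is inverted and followed by the chart of
    \<open>L\<close>; both start from the coordinates attached to \<open>d\<close>.\<close>
  have "quad_isometry (trace_zero_integers K) (trace_form K) trace_zero_coords (coord_form d) (inv_into UNIV \<phi>)"
    using \<phi>(2) by (rule quad_isometry_inverse) (simp_all add: \<phi>(1) trace_zero_coords_add)
  then have f: "quad_isometry (trace_zero_integers K) (trace_form K)
      (trace_zero_integers L) (trace_form L) (\<psi> \<circ> inv_into UNIV \<phi>)"
    using \<psi>(2) by (rule quad_isometry_compose)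
  have "quad_isometry (ring_of_integers K) (trace_form K) (integer_coords d) (coord_form d) (inv_into UNIV \<phi>)"
    using \<phi>(3) by (rule quad_isometry_inverse) (simp_all add: \<phi>(1) integer_coords_add)
  then have g: "quad_isometry (ring_of_integers K) (trace_form K)
      (ring_of_integers L) (trace_form L) (\<psi> \<circ> inv_into UNIV \<phi>)"
    using \<psi>(3) by (rule quad_isometry_compose)
  \<comment> \<open>The isometry is built from pairs of integers to \<open>L\<close> and then
    inverted to the required direction.\<close>
  have hex: "quad_isometry UNIV (hex_form (form_scale d)) (trace_zero_integers L) (trace_form L)
      (\<psi> \<circ> (\<lambda>(x, y). (0, of_int x, - of_int y)))" (is "quad_isometry _ _ _ _ ?h")
    using hex_form_coordinates \<psi>(2) by (rule quad_isometry_compose)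
  then have inj: "inj ?h"
    by (simp add: quad_isometry_def bij_betw_def)
  have "quad_isometry (trace_zero_integers L) (trace_form L) UNIV
      (hex_form (form_scale d)) (inv_into UNIV ?h)"
    using hex by (rule quad_isometry_inverse) (simp_all only: inv_f_f[OF inj] UNIV_I)
  then have "quad_isomorphic (trace_zero_integers L) (trace_form L) UNIV
      (hex_form (if \<not> 3 dvd d then 2 * of_nat d else 2 * of_nat d / 3))"
    unfolding quad_isomorphic_def form_scale_def by blast
  moreover have "quad_isomorphic (trace_zero_integers K) (trace_form K)
      (trace_zero_integers L) (trace_form L)"
    unfolding quad_isomorphic_def using f by blast
  \<comment> \<open>The same map is the witness for \<open>f\<close> and for \<open>g\<close>, so
    the extension property is immediate.\<close>
  moreover have "\<forall>x\<in>trace_zero_integers K. (\<psi> \<circ> inv_into UNIV \<phi>) x = (\<psi> \<circ> inv_into UNIV \<phi>) x"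
    by simp
  ultimately show ?thesis
    using f g by (intro conjI exI[of _ "\<psi> \<circ> inv_into UNIV \<phi>"])
qed

end
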